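(* Let $\lambda$ be a partition and let $(P_\lambda, \omega)$ be the Ferrers poset of $\lambda$ with a column strict labelling $\omega$. Then $E(P_\lambda, \omega)$ is real-rooted. Moreover, if $\lambda$ covers $\mu$ in Young's lattice, then $$E(P_\mu, \omega) \preceq E(P_\lambda, \omega),$$ where $P_\mu \subseteq P_\lambda$ is labelled by the restriction of $\omega$.
   Context: A labelled poset $(P,\omega)$ is a finite poset $P$ together with an injective function $\omega : P \to \mathbb{N}$ (a labelling). A $(P,\omega)$-partition with largest part $\le n$ is a map $\sigma : P \to [n]=\{1,\dots,n\}$ such that (1) if $x \le y$ in $P$ then $\sigma(x) \ge \sigma(y)$; (2) if $x<y$ in $P$ and $\omega(x)>\omega(y)$ then $\sigma(x)>\sigma(y)$. Let $e_k(P,\omega)$ be the number of surjective $(P,\omega)$-partitions $\sigma: P \to [k]$. The $E$-polynomial of $(P,\omega)$ is $$E(P,\omega) = \sum_{k=1}^{|P|} e_k(P,\omega)\,x^k \in \mathbb{R}[x]$$ for $P$ nonempty, and $E(\emptyset)=1$. For a partition $\lambda = (\lambda_1 \geq \lambda_2 \geq \cdots \geq \lambda_{\ell}>0)$, the Ferrers poset is $P_{\lambda} = \{(i,j) : i,j \text{ positive integers},\ 1\leq i \leq \ell,\ 1 \leq j \leq \lambda_i\}$ with the product order: $(i,j)\le(i',j')$ iff $i \le i'$ and $j\le j'$. A labelling $\omega$ of $P_\lambda$ is column strict if $\omega(i,j) >\omega(i+1,j)$ and $\omega(i,j) <\omega(i,j+1)$ whenever the elements involved belong to $P_\lambda$.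 Young's lattice is the set of all partitions (including the empty one) ordered by inclusion of diagrams; $\lambda$ covers $\mu$ iff $P_\mu$ is obtained from $P_\lambda$ by removing one (maximal) element. Interlacing: a nonzero polynomial is real-rooted if all its complex zeros are real (nonzero constants included). For nonzero real-rooted $f,g\in\mathbb{R}[x]$ with $\deg(f)=\deg(g)+1=d$, with zeros $\alpha_1 \leq \cdots \leq \alpha_d$ of $f$ and $\beta_1 \leq \cdots \leq \beta_{d-1}$ of $g$ (with multiplicity), $g \preceq f$ means $\alpha_1 \leq \beta_1 \leq \alpha_2 \leq \cdots \leq \beta_{d-1} \leq \alpha_d$. The relation $g \preceq f$ includes the requirement that both are real-rooted and $\deg(f)=\deg(g)+1$. *)

theory Defs
  imports
    Complex_Main
    "HOL-Library.FuncSet"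
    "HOL-Library.Multiset"
    "HOL-Library.Product_Order"
    "HOL-Computational_Algebra.Polynomial"
begin

section \<open>Labelled posets and the E-polynomial\<close>

text \<open>
  A finite poset is given by a finite carrier set with the order induced from its type. Only the
  values of a labelling on the carrier are relevant (see \<open>E_poly_cong\<close> below).
\<close>

definition labelled_poset :: "'a::order set \<Rightarrow> ('a \<Rightarrow> nat) \<Rightarrow> bool" where
  "labelled_poset P \<omega> \<longleftrightarrow> finite P \<and> inj_on \<omega> P"

text \<open>
  Maps out of \<open>P\<close> are extensional functions, so that counting them is meaningful.
\<close>

definition P_partitions :: "'a::order set \<Rightarrow> ('a \<Rightarrow> nat) \<Rightarrow> nat \<Rightarrow> ('a \<Rightarrow> nat) set" where
  "P_partitions P \<omega> n =
    {\<sigma> \<in> P \<rightarrow>\<^sub>E {1..n}.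
      (\<forall>x\<in>P. \<forall>y\<in>P. x \<le> y \<longrightarrow> \<sigma> x \<ge> \<sigma> y) \<and>
      (\<forall>x\<in>P. \<forall>y\<in>P. x < y \<and> \<omega> x > \<omega> y \<longrightarrow> \<sigma> x > \<sigma> y)}"

definition e_num :: "'a::order set \<Rightarrow> ('a \<Rightarrow> nat) \<Rightarrow> nat \<Rightarrow> nat" where
  "e_num P \<omega> k = card {\<sigma> \<in> P_partitions P \<omega> k. \<sigma> ` P = {1..k}}"

definition E_poly :: "'a::order set \<Rightarrow> ('a \<Rightarrow> nat) \<Rightarrow> real poly" where
  "E_poly P \<omega> =
    (if P = {} then 1 else (\<Sum>k = 1..card P. monom (of_nat (e_num P \<omega> k)) k))"

lemma E_poly_cong:
  assumes "\<And>x. x \<in> P \<Longrightarrow> \<omega> x = \<omega>' x"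
  shows "E_poly P \<omega> = E_poly P \<omega>'"
proof -
  have "P_partitions P \<omega> k = P_partitions P \<omega>' k" for k
    unfolding P_partitions_def using assms by simp
  thus ?thesis
    by (simp add: E_poly_def e_num_def)
qed

section \<open>Partitions, Ferrers posets and Young's lattice\<close>

definition is_partition :: "nat list \<Rightarrow> bool" where
  "is_partition lam \<longleftrightarrow> sorted_wrt (\<ge>) lam \<and> (\<forall>m\<in>set lam. m > 0)"

text \<open>
  The order on \<open>nat \<times> nat\<close> is the componentwise one. Rows and columns are numbered from 1, whereas
  list indexing starts at 0.
\<close>

definition ferrers :: "nat list \<Rightarrow> (nat \<times> nat) set" where
  "ferrers lam = {(i, j). 1 \<le> i \<and> i \<le> length lam \<and> 1 \<le> j \<and> j \<le> lam ! (i - 1)}"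

definition column_strict :: "nat list \<Rightarrow> (nat \<times> nat \<Rightarrow> nat) \<Rightarrow> bool" where
  "column_strict lam \<omega> \<longleftrightarrow>
    (\<forall>i j. (i, j) \<in> ferrers lam \<and> (i + 1, j) \<in> ferrers lam \<longrightarrow> \<omega> (i, j) > \<omega> (i + 1, j)) \<and>
    (\<forall>i j. (i, j) \<in> ferrers lam \<and> (i, j + 1) \<in> ferrers lam \<longrightarrow> \<omega> (i, j) < \<omega> (i, j + 1))"

text \<open>
  The covering relation of the set of all partitions ordered by inclusion of diagrams. A partition
  is determined by its diagram, so the strict order is strict inclusion of diagrams.
\<close>

definition young_covers :: "nat list \<Rightarrow> nat list \<Rightarrow> bool" where
  "young_covers lam mu \<longleftrightarrow>
    is_partition lam \<and> is_partition mu \<and> ferrers mu \<subset> ferrers lam \<and>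
    \<not> (\<exists>nu. is_partition nu \<and> ferrers mu \<subset> ferrers nu \<and> ferrers nu \<subset> ferrers lam)"

lemma finite_ferrers [simp]: "finite (ferrers lam)"
proof (rule finite_subset)
  show "ferrers lam \<subseteq> (SIGMA i:{1..length lam}. {1..lam ! (i - 1)})"
    by (auto simp: ferrers_def)
qed simp

lemma ferrers_down:
  assumes "is_partition lam" "(i, j) \<in> ferrers lam" "1 \<le> i'" "i' \<le> i" "1 \<le> j'" "j' \<le> j"
  shows "(i', j') \<in> ferrers lam"
proof -
  have "lam ! (i - 1) \<le> lam ! (i' - 1)"
  proof (cases "i' = i")
    case False
    hence "i' - 1 < i - 1" "i - 1 < length lam"
      using assms by (auto simp: ferrers_def)
    thus ?thesis
      using assms(1) by (auto simp: is_partition_def sorted_wrt_iff_nth_less)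
  qed simp
  thus ?thesis
    using assms by (auto simp: ferrers_def)
qed

lemma down_set_nat_eq:
  fixes A :: "nat set"
  assumes "finite A" "\<And>a. a \<in> A \<Longrightarrow> 1 \<le> a" "\<And>a b. a \<in> A \<Longrightarrow> 1 \<le> b \<Longrightarrow> b \<le> a \<Longrightarrow> b \<in> A"
  shows "A = {1..card A}"
proof (cases "A = {}")
  case False
  have "A = {1..Max A}"
  proof (intro subset_antisym subsetI)
    show "x \<in> {1..Max A}" if "x \<in> A" for x
      using that assms(1,2) by simp
    show "x \<in> A" if "x \<in> {1..Max A}" for x
      using that assms(3)[OF Max_in[OF assms(1) False]] by simp
  qed
  moreover from this have "card A = Max A"
    using card_atLeastAtMost[of 1 "Max A"] by simp
  ultimately show ?thesis
    by simp
qed simp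

lemma down_set_is_ferrers:
  assumes fin: "finite S"
    and pos: "\<And>i j. (i, j) \<in> S \<Longrightarrow> 1 \<le> i \<and> 1 \<le> j"
    and down: "\<And>i j i' j'. (i, j) \<in> S \<Longrightarrow> 1 \<le> i' \<Longrightarrow> i' \<le> i \<Longrightarrow> 1 \<le> j' \<Longrightarrow> j' \<le> j \<Longrightarrow> (i', j') \<in> S"
  shows "\<exists>nu. is_partition nu \<and> ferrers nu = S"
proof -
  define f where "f i = card {j. (i, j) \<in> S}" for i
  define r where "r = card {i. (i, 1) \<in> S}"
  define nu where "nu = map (\<lambda>i. f (Suc i)) [0..<r]"
  have fin_row: "finite {j. (i, j) \<in> S}" for i
    by (rule finite_subset[OF _ finite_imageI[OF fin, of snd]]) force
  have fin_col: "finite {i. (i, 1) \<in> S}"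
    by (rule finite_subset[OF _ finite_imageI[OF fin, of fst]]) force
  have row: "{j. (i, j) \<in> S} = {1..f i}" for i
    unfolding f_def
  proof (rule down_set_nat_eq[OF fin_row])
    show "1 \<le> a" if "a \<in> {j. (i, j) \<in> S}" for a
      using that pos by simp
    show "b \<in> {j. (i, j) \<in> S}" if "a \<in> {j. (i, j) \<in> S}" "1 \<le> b" "b \<le> a" for a b
      using that pos[of i a] down[of i a i b] by simp
  qed
  have col: "{i. (i, 1) \<in> S} = {1..r}"
    unfolding r_def
  proof (rule down_set_nat_eq[OF fin_col])
    show "1 \<le> a" if "a \<in> {i. (i, 1) \<in> S}" for a
      using that pos by simp
    show "b \<in> {i. (i, 1) \<in> S}" if "a \<in> {i. (i, 1) \<in> S}" "1 \<le> b" "b \<le> a" for a b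
      using that down[of a 1 b 1] by simp
  qed
  have mem_row: "(i, j) \<in> S \<longleftrightarrow> 1 \<le> j \<and> j \<le> f i" for i j
    using row[of i] by (auto simp: set_eq_iff)
  have mem_col: "(i, 1) \<in> S \<longleftrightarrow> 1 \<le> i \<and> i \<le> r" for i
    using col by (auto simp: set_eq_iff)
  have f_pos: "f i > 0 \<longleftrightarrow> 1 \<le> i \<and> i \<le> r" for i
    using mem_row[of i 1] mem_col[of i] by auto
  have f_mono: "f i' \<le> f i" if "1 \<le> i" "i \<le> i'" for i i'
  proof (cases "f i' = 0")
    case False
    hence "(i', f i') \<in> S" by (simp add: mem_row)
    hence "(i, f i') \<in> S" using down[of i' "f i'" i "f i'"] that False by simp
    thus ?thesis by (simp add: mem_row)
  qed simp
  have "is_partition nu"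
    unfolding is_partition_def nu_def
    by (auto simp: sorted_wrt_iff_nth_less f_pos intro!: f_mono)
  moreover have "(i, j) \<in> ferrers nu \<longleftrightarrow> (i, j) \<in> S" for i j
    using f_pos[of i] by (cases i) (auto simp: ferrers_def nu_def mem_row)
  ultimately show ?thesis
    by (intro exI[of _ nu]) auto
qed

lemma young_covers_iff:
  "young_covers lam mu \<longleftrightarrow>
    is_partition lam \<and> is_partition mu \<and> (\<exists>p\<in>ferrers lam. ferrers mu = ferrers lam - {p})"
proof (cases "is_partition lam \<and> is_partition mu")
  case parts: True
  show ?thesis
  proof
    assume cov: "young_covers lam mu"
    define D where "D = ferrers lam - ferrers mu"
    have sub: "ferrers mu \<subset> ferrers lam"
      using cov by (simp add: young_covers_def)
    hence "finite D" "D \<noteq> {}"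
      by (auto simp: D_def)
    then obtain p where p: "p \<in> D" "\<And>q. q \<in> D \<Longrightarrow> p \<le> q \<Longrightarrow> p = q"
      using finite_has_maximal[of D] by blast
    define S where "S = ferrers lam - {p}"
    have "\<exists>nu. is_partition nu \<and> ferrers nu = S"
    proof (rule down_set_is_ferrers)
      show "finite S" by (simp add: S_def)
      show "1 \<le> i \<and> 1 \<le> j" if "(i, j) \<in> S" for i j
        using that by (auto simp: S_def ferrers_def)
      show "(i', j') \<in> S"
        if "(i, j) \<in> S" "1 \<le> i'" "i' \<le> i" "1 \<le> j'" "j' \<le> j" for i j i' j'
      proof -
        have lam: "(i, j) \<in> ferrers lam" "(i', j') \<in> ferrers lam"
          using that parts ferrers_down[of lam i j i' j'] by (auto simp: S_def)
        have "(i', j') \<noteq> p"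
        proof
          assume eq: "(i', j') = p"
          have "(i, j) \<notin> ferrers mu"
            using ferrers_down[of mu i j i' j'] parts that p(1) eq by (auto simp: D_def)
          hence "p = (i, j)"
            using lam that eq by (intro p(2)) (auto simp: D_def)
          thus False
            using that by (simp add: S_def)
        qed
        thus ?thesis
          using lam by (simp add: S_def)
      qed
    qed
    then obtain nu where nu: "is_partition nu" "ferrers nu = ferrers lam - {p}"
      by (auto simp: S_def)
    have "ferrers mu \<subseteq> ferrers nu" "ferrers nu \<subset> ferrers lam"
      using sub p(1) nu(2) by (auto simp: D_def)
    hence "ferrers mu = ferrers nu"
      using cov nu(1) unfolding young_covers_def by blast
    thus "is_partition lam \<and> is_partition mu \<and> (\<exists>p\<in>ferrers lam. ferrers mu = ferrers lam - {p})"
      using parts nu(2) p(1) by (auto simp: D_def)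
  next
    assume "is_partition lam \<and> is_partition mu \<and> (\<exists>p\<in>ferrers lam. ferrers mu = ferrers lam - {p})"
    thus "young_covers lam mu"
      unfolding young_covers_def by blast
  qed
qed (auto simp: young_covers_def)

section \<open>Real-rootedness and interlacing\<close>

definition real_rooted :: "real poly \<Rightarrow> bool" where
  "real_rooted f \<longleftrightarrow>
    f \<noteq> 0 \<and> (\<forall>z::complex. poly (map_poly complex_of_real f) z = 0 \<longrightarrow> z \<in> \<real>)"

definition sorted_zeros :: "real poly \<Rightarrow> real list" where
  "sorted_zeros f = sorted_list_of_multiset (proots f)"

text \<open>
  \<open>interlaces g f\<close> stands for \<open>g \<preceq> f\<close>. For real-rooted polynomials, \<open>sorted_zeros\<close> has as many entries
  as the degree, so all list accesses below are within bounds.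
\<close>

definition interlaces :: "real poly \<Rightarrow> real poly \<Rightarrow> bool" where
  "interlaces g f \<longleftrightarrow>
    real_rooted f \<and> real_rooted g \<and> degree f = degree g + 1 \<and>
    (\<forall>i < degree g. sorted_zeros f ! i \<le> sorted_zeros g ! i \<and>
                    sorted_zeros g ! i \<le> sorted_zeros f ! (i + 1))"

end

theory Submission
  imports
    Defs
    "HOL-Library.Infinite_Set"
    "Jordan_Normal_Form.Determinant"
begin

text \<open>
  A surjection count determines the number of all \<open>(P, \<omega>)\<close>-partitions with largest part at most
  \<open>n\<close>, namely \<open>\<Omega>(n) = (\<Sum>k. e\<^sub>k * (n choose k))\<close>. For a column strict Ferrers poset these partitions are
  counted by a determinant of binomial coefficients (remove the entries equal to 1, which form a
  horizontal strip), hence by a Vandermonde product. If \<open>\<lambda>\<close> arises from \<open>\<mu>\<close> by adding a cell of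
  content \<open>c\<close>, the quotient of the two products shows that \<open>\<Omega>\<^sub>\<lambda>(n)\<close> is proportional to
  \<open>(n + c) * \<Omega>\<^sub>\<mu>(n)\<close>, so that \<open>E\<^sub>\<lambda>\<close> is proportional to \<open>x (1 + x) E\<^sub>\<mu>' + (c + x) E\<^sub>\<mu>\<close>.

  By induction \<open>E\<^sub>\<mu>\<close> has a zero of order \<open>a\<close> at 0, the number of rows, a zero of order \<open>b\<close> at -1,
  one less than the number of columns, and otherwise simple zeros in the open interval between.
  The content of an addable cell satisfies \<open>-a \<le> c \<le> b + 1\<close>, and for such \<open>c\<close> a sign count at the zeros
  of \<open>E\<^sub>\<mu>\<close> shows that the operator adds exactly one zero to each gap.
\<close>

hide_const (open) Module.smult

section \<open>Polynomials given by their zeros\<close>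

definition root_poly :: "real list \<Rightarrow> real poly" where
  "root_poly rs = (\<Prod>r\<leftarrow>rs. [:- r, 1:])"

lemma root_poly_simps [simp]:
  "root_poly [] = 1" "root_poly (r # rs) = [:- r, 1:] * root_poly rs"
  "root_poly (rs @ ts) = root_poly rs * root_poly ts"
  "root_poly (replicate n r) = [:- r, 1:] ^ n"
  by (simp_all add: root_poly_def map_replicate_const)

lemma lead_coeff_root_poly: "lead_coeff (root_poly rs) = 1"
  by (induction rs) (simp_all add: lead_coeff_mult del: mult_pCons_left)

lemma root_poly_nonzero [simp]: "root_poly rs \<noteq> 0"
  using lead_coeff_root_poly[of rs] by auto

lemma degree_root_poly [simp]: "degree (root_poly rs) = length rs"
  by (induction rs) (simp_all add: degree_mult_eq del: mult_pCons_left)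

lemma poly_root_poly: "poly (root_poly rs) t = (\<Prod>r\<leftarrow>rs. t - r)"
  by (induction rs) (simp_all del: mult_pCons_left)

text \<open>By the product rule, only the term that differentiates the factor vanishing at
  \<open>rs ! i\<close> survives there; distinctness makes this factor occur once.\<close>

lemma poly_pderiv_root_poly:
  assumes "distinct rs" "i < length rs"
  shows "poly (pderiv (root_poly rs)) (rs ! i) = (\<Prod>j\<in>{..<length rs} - {i}. rs ! i - rs ! j)"
proof -
  have eq: "rs = take i rs @ rs ! i # drop (Suc i) rs"
    using assms by (simp add: id_take_nth_drop)
  have dist: "distinct (take i rs @ rs ! i # drop (Suc i) rs)"
    unfolding eq[symmetric] by fact
  have set: "set rs = set (take i rs @ rs ! i # drop (Suc i) rs)"
    unfolding eq[symmetric] ..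
  define h where "h = root_poly (take i rs) * root_poly (drop (Suc i) rs)"
  have "root_poly rs = [:- (rs ! i), 1:] * h"
    by (subst eq) (simp add: h_def mult_ac del: mult_pCons_left mult_pCons_right)
  hence "poly (pderiv (root_poly rs)) (rs ! i) = poly h (rs ! i)"
    by (simp add: pderiv_mult pderiv_pCons del: mult_pCons_left)
  also have "\<dots> = (\<Prod>r\<leftarrow>take i rs @ drop (Suc i) rs. rs ! i - r)"
    by (simp add: h_def poly_root_poly)
  also have "\<dots> = (\<Prod>r\<in>set (take i rs @ drop (Suc i) rs). rs ! i - r)"
    using dist by (intro prod.distinct_set_conv_list[symmetric]) auto
  also have "set (take i rs @ drop (Suc i) rs) = (!) rs ` ({..<length rs} - {i})"
  proof -
    have "set (take i rs @ drop (Suc i) rs) = set rs - {rs ! i}"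
      using dist by (subst set) auto
    also have "\<dots> = (!) rs ` ({..<length rs} - {i})"
      using assms by (auto simp: in_set_conv_nth nth_eq_iff_index_eq)
    finally show ?thesis .
  qed
  also have "(\<Prod>r\<in>(!) rs ` ({..<length rs} - {i}). rs ! i - r) =
      (\<Prod>j\<in>{..<length rs} - {i}. rs ! i - rs ! j)"
    using assms(1) by (subst prod.reindex) (auto simp: inj_on_def nth_eq_iff_index_eq)
  finally show ?thesis .
qed

lemma prod_neg_sign:
  fixes f :: "'b \<Rightarrow> real"
  assumes "finite A" "\<And>x. x \<in> A \<Longrightarrow> f x < 0"
  shows "(-1) ^ card A * prod f A > 0"
proof -
  have "(-1) ^ card A * prod f A = (\<Prod>x\<in>A. - f x)"
    using assms(1) by (simp add: prod_uminus)
  also have "\<dots> > 0"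
    by (rule prod_pos) (use assms in auto)
  finally show ?thesis .
qed

lemma real_rooted_root_poly:
  assumes "k \<noteq> 0"
  shows "real_rooted (smult k (root_poly rs))"
proof -
  have 1: "map_poly complex_of_real (smult k p) = smult (of_real k) (map_poly of_real p)" for p
    by (intro poly_eqI) (simp add: coeff_map_poly)
  have 2: "map_poly complex_of_real (root_poly rs) = (\<Prod>r\<leftarrow>rs. [:- of_real r, 1:])"
  proof (induction rs)
    case (Cons r rs)
    have "map_poly complex_of_real ([:- r, 1:] * root_poly rs) = [:- of_real r, 1:] * map_poly of_real (root_poly rs)"
      by (intro poly_eqI) (simp add: coeff_map_poly coeff_pCons split: nat.split)
    thus ?case using Cons by (simp del: mult_pCons_left)
  qed (simp add: map_poly_1)
  have 3: "poly (\<Prod>r\<leftarrow>rs. [:- complex_of_real r, 1:]) z = (\<Prod>r\<leftarrow>rs. z - of_real r)" for z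
    by (induction rs) (simp_all del: mult_pCons_left)
  show ?thesis
    unfolding real_rooted_def 1 2 using assms by (auto simp: 3 prod_list_zero_iff)
qed

lemma sorted_zeros_root_poly:
  assumes "k \<noteq> 0" "sorted rs"
  shows "sorted_zeros (smult k (root_poly rs)) = rs"
proof -
  have "proots (root_poly rs) = mset rs"
    by (induction rs) (simp_all add: proots_mult del: mult_pCons_left)
  thus ?thesis using assms by (simp add: sorted_zeros_def sorted_sort_id)
qed

lemma interlaces_root_poly:
  assumes "k \<noteq> 0" "k' \<noteq> 0" "sorted rs" "sorted qs" "length qs = Suc (length rs)"
    and "\<And>i. i < length rs \<Longrightarrow> qs ! i \<le> rs ! i \<and> rs ! i \<le> qs ! Suc i"
  shows "interlaces (smult k (root_poly rs)) (smult k' (root_poly qs))"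
  using assms by (simp add: interlaces_def real_rooted_root_poly sorted_zeros_root_poly)

lemma prod_linear_monic:
  fixes c :: "'b \<Rightarrow> 'a :: idom"
  shows "degree (\<Prod>i\<in>A. [:- c i, 1:]) = card A" "lead_coeff (\<Prod>i\<in>A. [:- c i, 1:]) = 1"
proof -
  show "degree (\<Prod>i\<in>A. [:- c i, 1:]) = card A"
    by (subst degree_prod_eq_sum_degree) auto
  show "lead_coeff (\<Prod>i\<in>A. [:- c i, 1:]) = 1"
    by (simp add: lead_coeff_prod)
qed

text \<open>Both sides agree on \<open>R\<close> and in the coefficient of index
  \<open>card R\<close>, which determines a polynomial of degree at most \<open>card R\<close>. That
  coefficient is allowed to vanish.\<close>

lemma poly_eq_smult_prod_roots:
  fixes p :: "'a :: idom poly"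
  assumes "finite R" "degree p \<le> card R" "\<And>r. r \<in> R \<Longrightarrow> poly p r = 0"
  shows "p = smult (coeff p (card R)) (\<Prod>r\<in>R. [:- r, 1:])"
proof (rule poly_eqI_degree_lead_coeff)
  note monic = prod_linear_monic[of "\<lambda>r. r" R]
  show "coeff p (card R) = coeff (smult (coeff p (card R)) (\<Prod>r\<in>R. [:- r, 1:])) (card R)"
    using monic by simp
  show "card R \<le> card R" "degree p \<le> card R" by (simp_all add: assms)
  show "degree (smult (coeff p (card R)) (\<Prod>r\<in>R. [:- r, 1:])) \<le> card R"
    using monic degree_smult_le by metis
  show "poly p r = poly (smult (coeff p (card R)) (\<Prod>r\<in>R. [:- r, 1:])) r" if "r \<in> R" for r
    using that assms by (auto simp: poly_prod prod_zero_iff)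
qed

section \<open>The operator that adds a cell\<close>

text \<open>Adding a cell of content \<open>c\<close> uses \<open>d = 1\<close>. Other values of
  \<open>d\<close> arise when powers of x and 1 + x are pulled out of \<open>F\<close>.\<close>

definition content_op :: "real \<Rightarrow> real \<Rightarrow> real poly \<Rightarrow> real poly" where
  "content_op c d F = [:0, 1, 1:] * pderiv F + [:c, d:] * F"

lemma coeff_content_op:
  "coeff (content_op c d F) k =
    (if k = 0 then 0 else (real k - 1 + d) * coeff F (k - 1)) + (real k + c) * coeff F k"
proof -
  have "[:0, 1, 1:] * pderiv F = pCons 0 (pderiv F + pCons 0 (pderiv F))"
    by simp
  thus ?thesis
    by (cases k) (auto simp: content_op_def coeff_pderiv coeff_pCons algebra_simps split: nat.splits)
qed

section \<open>Counting by image size\<close>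

text \<open>Composition with the increasing bijection from \<open>{1..card A}\<close> onto
  \<open>A\<close> preserves and reflects weak and strict inequalities, hence both conditions on a
  partition.\<close>

lemma card_P_partitions_image:
  fixes P :: "'a::order set"
  assumes A: "A \<subseteq> {1..n}"
  shows "card {\<sigma> \<in> P_partitions P \<omega> n. \<sigma> ` P = A} = e_num P \<omega> (card A)"
proof -
  have "finite A" using A by (rule finite_subset) simp
  then obtain h0 where h0: "bij_betw h0 {..<card A} A" "strict_mono_on {..<card A} h0"
    by (rule ex_bij_betw_strict_mono_card)
  \<comment> \<open>\<open>h0\<close> is indexed from 0, whereas the values of partitions start at
    1.\<close>
  define h where "h k = h0 (k - 1)" for k
  have h_bij: "bij_betw h {1..card A} A"
  proof -
    have "bij_betw (\<lambda>k. k - 1) {1..card A} {..<card A}"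
      by (rule bij_betw_byWitness[of _ Suc]) auto
    from bij_betw_trans[OF this h0(1)] show ?thesis by (simp add: comp_def h_def[abs_def])
  qed
  have h_less: "h i < h j \<longleftrightarrow> i < j" if "i \<in> {1..card A}" "j \<in> {1..card A}" for i j
  proof -
    have "h i < h j" if "i < j" "i \<in> {1..card A}" "j \<in> {1..card A}" for i j
      unfolding h_def by (rule strict_mono_onD[OF h0(2)]) (use that in auto)
    from this[of i j] this[of j i] that show ?thesis by (metis less_asym linorder_less_linear)
  qed
  have h_le: "h i \<le> h j \<longleftrightarrow> i \<le> j" if "i \<in> {1..card A}" "j \<in> {1..card A}" for i j
    using h_less[OF that(2,1)] by (simp add: linorder_not_less[symmetric])
  define g where "g = inv_into {1..card A} h"
  have hg: "h (g a) = a" "g a \<in> {1..card A}" if "a \<in> A" for a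
    using that h_bij inv_into_into[of a h "{1..card A}"]
    by (simp_all add: g_def bij_betw_inv_into_right bij_betw_def del: atLeastAtMost_iff)
  have gh: "g (h k) = k" if "k \<in> {1..card A}" for k
    using that h_bij by (simp add: g_def bij_betw_inv_into_left)
  have hA: "h ` {1..card A} = A" using h_bij by (simp add: bij_betw_def)
  let ?X = "{\<sigma> \<in> P_partitions P \<omega> (card A). \<sigma> ` P = {1..card A}}"
  let ?Y = "{\<sigma> \<in> P_partitions P \<omega> n. \<sigma> ` P = A}"
  have "bij_betw (\<lambda>\<sigma>. \<lambda>x\<in>P. h (\<sigma> x)) ?X ?Y"
  proof (rule bij_betw_byWitness[of _ "\<lambda>\<sigma>. \<lambda>x\<in>P. g (\<sigma> x)"])
    show "\<forall>\<sigma>\<in>?X. (\<lambda>x\<in>P. g ((\<lambda>x\<in>P. h (\<sigma> x)) x)) = \<sigma>"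
    proof (intro ballI ext)
      fix \<sigma> x assume \<sigma>: "\<sigma> \<in> ?X"
      hence "\<sigma> \<in> P \<rightarrow>\<^sub>E {1..card A}" by (simp add: P_partitions_def)
      thus "(\<lambda>x\<in>P. g ((\<lambda>x\<in>P. h (\<sigma> x)) x)) x = \<sigma> x"
        using PiE_mem[of \<sigma> P "\<lambda>_. {1..card A}" x] PiE_arb[of \<sigma> P _ x] gh[of "\<sigma> x"]
        by (cases "x \<in> P") simp_all
    qed
    show "\<forall>\<sigma>\<in>?Y. (\<lambda>x\<in>P. h ((\<lambda>x\<in>P. g (\<sigma> x)) x)) = \<sigma>"
    proof (intro ballI ext)
      fix \<sigma> x assume \<sigma>: "\<sigma> \<in> ?Y"
      hence "\<sigma> \<in> P \<rightarrow>\<^sub>E {1..n}" "\<sigma> ` P = A" by (simp_all add: P_partitions_def)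
      thus "(\<lambda>x\<in>P. h ((\<lambda>x\<in>P. g (\<sigma> x)) x)) x = \<sigma> x"
        using PiE_arb[of \<sigma> P _ x] hg(1)[of "\<sigma> x"] by (cases "x \<in> P") auto
    qed
    show "(\<lambda>\<sigma>. \<lambda>x\<in>P. h (\<sigma> x)) ` ?X \<subseteq> ?Y"
    proof clarify
      fix \<sigma> assume \<sigma>: "\<sigma> \<in> P_partitions P \<omega> (card A)" "\<sigma> ` P = {1..card A}"
      have mem: "\<sigma> x \<in> {1..card A}" if "x \<in> P" for x using that \<sigma>(2) by blast
      have "(\<lambda>x\<in>P. h (\<sigma> x)) ` P = h ` \<sigma> ` P"
        by (simp add: image_image)
      also have "\<dots> = A"
        unfolding \<sigma>(2) by (rule hA)
      finally have img: "(\<lambda>x\<in>P. h (\<sigma> x)) ` P = A" .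
      moreover have "(\<lambda>x\<in>P. h (\<sigma> x)) \<in> P \<rightarrow>\<^sub>E {1..n}"
        using img A by auto
      ultimately show "(\<lambda>x\<in>P. h (\<sigma> x)) \<in> P_partitions P \<omega> n \<and> (\<lambda>x\<in>P. h (\<sigma> x)) ` P = A"
        using \<sigma>(1) mem by (simp add: P_partitions_def h_le h_less del: atLeastAtMost_iff)
    qed
    show "(\<lambda>\<sigma>. \<lambda>x\<in>P. g (\<sigma> x)) ` ?Y \<subseteq> ?X"
    proof clarify
      fix \<sigma> assume \<sigma>: "\<sigma> \<in> P_partitions P \<omega> n" "A = \<sigma> ` P"
      have mem: "g (\<sigma> x) \<in> {1..card A}" "h (g (\<sigma> x)) = \<sigma> x" if "x \<in> P" for x
        using that \<sigma>(2) hg by auto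
      have g_le: "g (\<sigma> x) \<le> g (\<sigma> y) \<longleftrightarrow> \<sigma> x \<le> \<sigma> y" "g (\<sigma> x) < g (\<sigma> y) \<longleftrightarrow> \<sigma> x < \<sigma> y" if "x \<in> P" "y \<in> P" for x y
        using h_le[OF mem(1)[OF that(1)] mem(1)[OF that(2)]] h_less[OF mem(1)[OF that(1)] mem(1)[OF that(2)]]
          mem(2)[OF that(1)] mem(2)[OF that(2)] by auto
      have "g ` A = {1..card A}"
        using h_bij unfolding g_def by (intro bij_betw_imp_surj_on bij_betw_inv_into)
      hence img: "(\<lambda>x\<in>P. g (\<sigma> x)) ` P = {1..card A}"
        using \<sigma>(2) by (simp add: image_image)
      have "(\<lambda>x\<in>P. g (\<sigma> x)) \<in> P \<rightarrow>\<^sub>E {1..card A}"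
        using mem(1) by (auto simp del: atLeastAtMost_iff)
      hence "(\<lambda>x\<in>P. g (\<sigma> x)) \<in> P_partitions P \<omega> (card A) \<and> (\<lambda>x\<in>P. g (\<sigma> x)) ` P = {1..card A}"
        using \<sigma>(1) img by (simp add: P_partitions_def g_le)
      thus "(\<lambda>x\<in>P. g (\<sigma> x)) \<in> P_partitions P \<omega> (card (\<sigma> ` P)) \<and>
          (\<lambda>x\<in>P. g (\<sigma> x)) ` P = {1..card (\<sigma> ` P)}"
        using \<sigma>(2) by simp
    qed
  qed
  from bij_betw_same_card[OF this] show ?thesis by (simp add: e_num_def)
qed

lemma finite_P_partitions: "finite P \<Longrightarrow> finite (P_partitions P \<omega> n)"
  by (rule finite_subset[of _ "P \<rightarrow>\<^sub>E {1..n}"]) (auto simp: P_partitions_def intro: finite_PiE)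

text \<open>The partitions are sorted by their image; each of the \<open>n choose k\<close> subsets
  of size \<open>k\<close> is the image of \<open>e_num P \<omega> k\<close> of them.\<close>

lemma card_P_partitions:
  assumes "finite P"
  shows "card (P_partitions P \<omega> n) = (\<Sum>k\<le>n. (n choose k) * e_num P \<omega> k)"
proof -
  have "P_partitions P \<omega> n = (\<Union>A\<in>Pow {1..n}. {\<sigma> \<in> P_partitions P \<omega> n. \<sigma> ` P = A})"
    by (auto simp: P_partitions_def)
  also have "card \<dots> = (\<Sum>A\<in>Pow {1..n}. card {\<sigma> \<in> P_partitions P \<omega> n. \<sigma> ` P = A})"
    by (rule card_UN_disjoint) (auto simp: finite_P_partitions assms)
  also have "\<dots> = (\<Sum>A\<in>Pow {1..n}. e_num P \<omega> (card A))"
    by (intro sum.cong) (auto simp: card_P_partitions_image assms)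
  also have "\<dots> = (\<Sum>k\<le>n. \<Sum>A | A \<in> Pow {1..n} \<and> card A = k. e_num P \<omega> (card A))"
  proof (rule sum.group[symmetric])
    show "card ` Pow {1..n} \<subseteq> {..n}"
      using card_mono[of "{1..n}"] by fastforce
  qed auto
  also have "\<dots> = (\<Sum>k\<le>n. (n choose k) * e_num P \<omega> k)"
  proof (intro sum.cong refl)
    fix k
    have "(\<Sum>A | A \<in> Pow {1..n} \<and> card A = k. e_num P \<omega> (card A)) =
        card {A. A \<subseteq> {1..n} \<and> card A = k} * e_num P \<omega> k"
      by simp
    thus "(\<Sum>A | A \<in> Pow {1..n} \<and> card A = k. e_num P \<omega> (card A)) = (n choose k) * e_num P \<omega> k"
      by (simp add: n_subsets)
  qed
  finally show ?thesis .
qed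

text \<open>The convention for \<open>P = {}\<close> fits because the empty map is onto
  \<open>{1..0}\<close>; for nonempty \<open>P\<close> no surjection exists when \<open>k\<close>
  lies outside \<open>{1..card P}\<close>.\<close>

lemma coeff_E_poly:
  assumes "finite P"
  shows "coeff (E_poly P \<omega>) k = real (e_num P \<omega> k)"
proof (cases "P = {}")
  case True
  have "e_num P \<omega> k = (if k = 0 then 1 else 0)"
    using True by (auto simp: e_num_def P_partitions_def)
  thus ?thesis using True by (simp add: E_poly_def coeff_1)
next
  case False
  have "e_num P \<omega> k = 0" if "k \<notin> {1..card P}"
  proof -
    have "{\<sigma> \<in> P_partitions P \<omega> k. \<sigma> ` P = {1..k}} = {}"
    proof (rule ccontr)
      assume "{\<sigma> \<in> P_partitions P \<omega> k. \<sigma> ` P = {1..k}} \<noteq> {}"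
      then obtain \<sigma> where \<sigma>: "\<sigma> ` P = {1..k}" by blast
      hence "k \<noteq> 0" using False by auto
      moreover have "k \<le> card P" using card_image_le[OF assms, of \<sigma>] \<sigma> by simp
      ultimately show False using that by simp
    qed
    thus ?thesis by (simp only: e_num_def card.empty)
  qed
  thus ?thesis using False by (auto simp: E_poly_def coeff_sum sum.delta)
qed

section \<open>Passing between counts and coefficients\<close>

text \<open>The linear system is triangular with diagonal entries \<open>n choose n\<close>, which
  are 1, so its solution is unique.\<close>

lemma binomial_sum_inj:
  fixes a b :: "nat \<Rightarrow> real"
  assumes "\<And>n. (\<Sum>k\<le>n. real (n choose k) * a k) = (\<Sum>k\<le>n. real (n choose k) * b k)"
  shows "a n = b n"
proof (induction n rule: less_induct)
  case (less n)
  have "(\<Sum>k<n. real (n choose k) * a k) = (\<Sum>k<n. real (n choose k) * b k)"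
    using less by (intro sum.cong) auto
  thus ?case
    using assms[of n] by (simp add: lessThan_Suc_atMost[symmetric])
qed

text \<open>The map sending the binomial polynomial \<open>x choose k\<close> to \<open>x ^ k\<close> intertwines multiplication
  by \<open>x + c\<close> with \<open>content_op c 1\<close>.\<close>

lemma binomial_sum_content_op:
  "(\<Sum>k\<le>n. real (n choose k) * coeff (content_op c 1 F) k) =
    (real n + c) * (\<Sum>k\<le>n. real (n choose k) * coeff F k)"
proof -
  \<comment> \<open>After an index shift, the absorption identity
    \<open>(k + 1) * (n choose (k + 1)) = (n - k) * (n choose k)\<close> produces the weight
    \<open>n - k\<close>; together with the other weight \<open>k + c\<close> it gives
    \<open>n + c\<close>.\<close>
  have "(\<Sum>k\<le>n. real (n choose k) * (if k = 0 then 0 else real k * coeff F (k - 1))) =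
      (\<Sum>k\<le>n. real (n choose k) * (real n - real k) * coeff F k)"
  proof (cases n)
    case (Suc m)
    have absorb: "real (Suc m choose Suc k) * real (Suc k) = real (Suc m choose k) * (real (Suc m) - real k)"
      if "k \<le> m" for k
    proof -
      have "Suc k * (Suc m choose Suc k) = (Suc m - k) * (Suc m choose k)"
        using binomial_absorb_comp[of "Suc m" k] Suc_times_binomial[of k m]
        by (simp del: binomial_Suc_Suc mult_Suc)
      hence "real (Suc k * (Suc m choose Suc k)) = real ((Suc m - k) * (Suc m choose k))" by (rule arg_cong)
      thus ?thesis using that by (simp add: of_nat_diff mult_ac del: binomial_Suc_Suc mult_Suc of_nat_Suc)
    qed
    have "(\<Sum>k\<le>Suc m. real (Suc m choose k) * (if k = 0 then 0 else real k * coeff F (k - 1))) =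
        (\<Sum>k\<le>m. real (Suc m choose Suc k) * real (Suc k) * coeff F k)"
      by (subst sum.atMost_Suc_shift) (simp add: mult.assoc)
    also have "\<dots> = (\<Sum>k\<le>m. real (Suc m choose k) * (real (Suc m) - real k) * coeff F k)"
      by (intro sum.cong refl) (simp only: absorb atMost_iff)
    also have "\<dots> = (\<Sum>k\<le>Suc m. real (Suc m choose k) * (real (Suc m) - real k) * coeff F k)"
      by (simp del: of_nat_Suc binomial_Suc_Suc)
    finally show ?thesis using Suc by simp
  qed simp
  moreover have "coeff (content_op c 1 F) k =
      (if k = 0 then 0 else real k * coeff F (k - 1)) + (real k + c) * coeff F k" for k
    by (simp add: coeff_content_op)
  ultimately show ?thesis
    by (simp add: distrib_left sum.distrib sum_distrib_left algebra_simps sum_subtractf)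
qed

text \<open>Transfers a proportionality of counts to the polynomials: the counts are the binomial
  sums of the coefficients, and these sums determine the coefficients.\<close>

lemma content_op_E_poly:
  assumes "finite P" "finite Q"
    and "\<And>n. real (card (P_partitions P \<omega> n)) * K = real (card (P_partitions Q \<omega> n)) * (real n + c)"
  shows "smult K (E_poly P \<omega>) = content_op c 1 (E_poly Q \<omega>)"
proof (rule poly_eqI, rule binomial_sum_inj)
  fix n
  have *: "real (card (P_partitions R \<omega> n)) = (\<Sum>k\<le>n. real (n choose k) * coeff (E_poly R \<omega>) k)"
    if "finite R" for R using that by (simp add: card_P_partitions coeff_E_poly)
  show "(\<Sum>k\<le>n. real (n choose k) * coeff (smult K (E_poly P \<omega>)) k) =
      (\<Sum>k\<le>n. real (n choose k) * coeff (content_op c 1 (E_poly Q \<omega>)) k)"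
    using assms(3)[of n] unfolding binomial_sum_content_op *[OF assms(1)] *[OF assms(2)]
    by (simp add: sum_distrib_left mult_ac)
qed

section \<open>Determinants of binomial coefficients\<close>

text \<open>The columns run through the degrees \<open>n - 1\<close> down to 0, so that the
  Vandermonde product appears with factors \<open>x i - x j\<close> for \<open>i < j\<close> and no
  extra sign.\<close>

definition binomial_mat :: "nat \<Rightarrow> (nat \<Rightarrow> real) \<Rightarrow> real mat" where
  "binomial_mat n x = mat n n (\<lambda>(i, j). x i gchoose (n - 1 - j))"

definition gbinomial_poly :: "nat \<Rightarrow> real poly" where
  "gbinomial_poly k = smult (1 / fact k) (\<Prod>i<k. [:- of_nat i, 1:])"

lemma poly_gbinomial_poly: "poly (gbinomial_poly k) t = t gchoose k"
  by (simp add: gbinomial_poly_def poly_prod gbinomial_prod_rev atLeast0LessThan)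

lemma degree_gbinomial_poly: "degree (gbinomial_poly k) = k"
  using prod_linear_monic(1)[of "\<lambda>i. of_nat i :: real" "{..<k}"] by (simp add: gbinomial_poly_def)

lemma coeff_gbinomial_poly: "coeff (gbinomial_poly k) k = 1 / fact k"
  using prod_linear_monic[of "\<lambda>i. of_nat i :: real" "{..<k}"] by (simp add: gbinomial_poly_def)

text \<open>As a polynomial in the last node, the determinant has degree at most \<open>n\<close>
  and vanishes at the other nodes, where two rows coincide. Its coefficient of degree
  \<open>n\<close> comes from the cofactor of the first column, which is the smaller determinant up
  to sign.\<close>

lemma det_binomial_mat_Suc:
  assumes inj: "inj_on x {..<n}"
  shows "det (binomial_mat (Suc n) x) * fact n = det (binomial_mat n x) * (\<Prod>i<n. x i - x n)"
proof -
  define A where "A = binomial_mat (Suc n) x"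
  have A: "A \<in> carrier_mat (Suc n) (Suc n)" by (simp add: A_def binomial_mat_def)
  define cof where "cof j = cofactor A n j" for j
  \<comment> \<open>The cofactors along the last row do not involve \<open>x n\<close>, so
    \<open>p\<close> is the determinant with \<open>x n\<close> replaced by an
    indeterminate.\<close>
  define p where "p = (\<Sum>j<Suc n. smult (cof j) (gbinomial_poly (n - j)))"
  have poly_p: "poly p t = (\<Sum>j<Suc n. (t gchoose (n - j)) * cof j)" for t
    by (simp add: p_def poly_sum poly_gbinomial_poly mult.commute)
  have "det A = (\<Sum>j<Suc n. A $$ (n, j) * cof j)"
    unfolding cof_def by (rule laplace_expansion_row[OF A]) simp
  also have "\<dots> = poly p (x n)"
    unfolding poly_p by (intro sum.cong) (auto simp: A_def binomial_mat_def)
  finally have detA: "det A = poly p (x n)" .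
  have root: "poly p (x i) = 0" if "i < n" for i
  proof -
    \<comment> \<open>Evaluating \<open>p\<close> at \<open>x i\<close> amounts to copying row
      \<open>i\<close> into the last row.\<close>
    define A' where "A' = mat (Suc n) (Suc n) (\<lambda>(k, j). if k = n then A $$ (i, j) else A $$ (k, j))"
    have A': "A' \<in> carrier_mat (Suc n) (Suc n)" by (simp add: A'_def)
    have "mat_delete A' n j = mat_delete A n j" for j
      using A by (intro eq_matI) (auto simp: mat_delete_def A'_def)
    hence "cofactor A' n j = cof j" for j
      by (simp add: cofactor_def cof_def)
    hence "det A' = (\<Sum>j<Suc n. A' $$ (n, j) * cof j)"
      using laplace_expansion_row[OF A', of n] by simp
    also have "\<dots> = poly p (x i)"
      unfolding poly_p using that
      by (intro sum.cong) (auto simp: A_def A'_def binomial_mat_def)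
    finally have "det A' = poly p (x i)" .
    moreover have "det A' = 0"
      by (rule det_identical_rows[OF A', of i n])
        (use that A in \<open>auto simp: A'_def intro!: eq_vecI\<close>)
    ultimately show ?thesis by simp
  qed
  have card: "card (x ` {..<n}) = n"
    using card_image[OF inj] by simp
  have "p = smult (coeff p (card (x ` {..<n}))) (\<Prod>r\<in>x ` {..<n}. [:- r, 1:])"
  proof (rule poly_eq_smult_prod_roots)
    show "degree p \<le> card (x ` {..<n})"
      unfolding card p_def
      by (intro degree_sum_le order_trans[OF degree_smult_le]) (auto simp: degree_gbinomial_poly)
  qed (use root in auto)
  hence p_eq: "p = smult (coeff p n) (\<Prod>i<n. [:- x i, 1:])"
    using inj by (simp add: card prod.reindex)
  have "coeff p n = (\<Sum>j<Suc n. cof j * coeff (gbinomial_poly (n - j)) n)"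
    by (simp add: p_def coeff_sum)
  \<comment> \<open>Only column 0 carries a binomial polynomial of degree \<open>n\<close>.\<close>
  also have "\<dots> = (\<Sum>j<Suc n. if j = 0 then cof j * coeff (gbinomial_poly (n - j)) n else 0)"
  proof (intro sum.cong refl)
    fix j
    have "j \<noteq> 0 \<Longrightarrow> j \<in> {..<Suc n} \<Longrightarrow> coeff (gbinomial_poly (n - j)) n = 0"
      by (rule coeff_eq_0) (auto simp: degree_gbinomial_poly)
    thus "j \<in> {..<Suc n} \<Longrightarrow> cof j * coeff (gbinomial_poly (n - j)) n =
        (if j = 0 then cof j * coeff (gbinomial_poly (n - j)) n else 0)" by auto
  qed
  also have "\<dots> = cof 0 / fact n"
    by (subst sum.delta) (auto simp: coeff_gbinomial_poly)
  finally have coeff_p: "coeff p n = cof 0 / fact n" .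
  have "mat_delete A n 0 = binomial_mat n x"
    by (intro eq_matI) (auto simp: mat_delete_def A_def binomial_mat_def)
  hence "cof 0 = (-1) ^ n * det (binomial_mat n x)"
    by (simp add: cof_def cofactor_def)
  hence "det A * fact n = det (binomial_mat n x) * ((-1) ^ n * (\<Prod>i<n. x n - x i))"
    unfolding detA by (subst p_eq) (simp add: coeff_p poly_prod)
  also have "(-1) ^ n * (\<Prod>i<n. x n - x i) = (\<Prod>i<n. - 1 * (x n - x i))"
    by (subst prod.distrib) simp
  also have "\<dots> = (\<Prod>i<n. x i - x n)"
    by (intro prod.cong) auto
  finally show ?thesis by (simp add: A_def)
qed

lemma det_binomial_mat:
  assumes "inj_on x {..<n}"
  shows "det (binomial_mat n x) * (\<Prod>j<n. fact j) = (\<Prod>j<n. \<Prod>i<j. x i - x j)"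
  using assms
proof (induction n)
  case 0
  show ?case by (simp add: binomial_mat_def)
next
  case (Suc n)
  have inj: "inj_on x {..<n}"
    using Suc.prems by (rule inj_on_subset) auto
  have "det (binomial_mat (Suc n) x) * (\<Prod>j<Suc n. fact j) =
      det (binomial_mat (Suc n) x) * fact n * (\<Prod>j<n. fact j)"
    by simp
  also have "\<dots> = (det (binomial_mat n x) * (\<Prod>j<n. fact j)) * (\<Prod>i<n. x i - x n)"
    unfolding det_binomial_mat_Suc[OF inj] by (simp only: mult_ac)
  finally show ?case
    by (simp only: Suc.IH[OF inj] prod.lessThan_Suc)
qed

text \<open>Subtracting from each row its successor keeps the determinant and clears the last
  column, which is constantly 1, except for its last entry; expanding along it leaves the
  differences.\<close>

lemma det_binomial_mat_diff:
  "det (binomial_mat (Suc n) x) =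
    det (mat n n (\<lambda>(i, j). (x i gchoose (n - j)) - (x (Suc i) gchoose (n - j))))"
proof -
  define A where "A = binomial_mat (Suc n) x"
  \<comment> \<open>Left multiplication by this unitriangular matrix performs all the row
    subtractions at once.\<close>
  define U :: "real mat" where
    "U = mat (Suc n) (Suc n) (\<lambda>(i, j). if j = i then 1 else if j = Suc i then -1 else 0)"
  have A: "A \<in> carrier_mat (Suc n) (Suc n)" by (simp add: A_def binomial_mat_def)
  have U: "U \<in> carrier_mat (Suc n) (Suc n)" by (simp add: U_def)
  have "det U = prod_list (diag_mat U)"
    by (rule det_upper_triangular[OF _ U]) (auto simp: U_def)
  also have "\<dots> = 1"
    unfolding prod_list_diag_prod by (rule prod.neutral) (auto simp: U_def)
  finally have detU: "det U = 1" .
  define M where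
    "M = mat (Suc n) (Suc n) (\<lambda>(i, j). if i < n then A $$ (i, j) - A $$ (Suc i, j) else A $$ (i, j))"
  have M: "M \<in> carrier_mat (Suc n) (Suc n)" by (simp add: M_def)
  have UA: "U * A = M"
  proof (rule eq_matI)
    fix i j assume ij: "i < dim_row M" "j < dim_col M"
    have "(U * A) $$ (i, j) = (\<Sum>k<Suc n. U $$ (i, k) * A $$ (k, j))"
      using ij A U M by (simp add: scalar_prod_def atLeast0LessThan)
    also have "\<dots> = (\<Sum>k<Suc n. (if k = i then A $$ (k, j) else 0) - (if k = Suc i then A $$ (k, j) else 0))"
      using ij M by (intro sum.cong) (auto simp: U_def)
    also have "\<dots> = M $$ (i, j)"
      unfolding sum_subtractf using ij M by (auto simp: M_def simp del: sum.lessThan_Suc)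
    finally show "(U * A) $$ (i, j) = M $$ (i, j)" .
  qed (use A U M in auto)
  have "det A = det M"
    using det_mult[OF U A] detU UA by simp
  also have "\<dots> = (\<Sum>i<Suc n. M $$ (i, n) * cofactor M i n)"
    by (rule laplace_expansion_column[OF M]) simp
  also have "\<dots> = (\<Sum>i<Suc n. if i = n then cofactor M i n else 0)"
    by (intro sum.cong) (auto simp: M_def A_def binomial_mat_def)
  also have "\<dots> = det (mat_delete M n n)"
    by (subst sum.delta) (auto simp: cofactor_def)
  also have "mat_delete M n n =
      mat n n (\<lambda>(i, j). (x i gchoose (n - j)) - (x (Suc i) gchoose (n - j)))"
    by (intro eq_matI) (auto simp: mat_delete_def M_def A_def binomial_mat_def)
  finally show ?thesis by (simp add: A_def)
qed

text \<open>Multilinearity in the rows: in the Leibniz formula, a sum over independent choices for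
  the rows distributes over the product.\<close>

lemma sum_det_rows_PiE:
  fixes f :: "nat \<Rightarrow> 'b \<Rightarrow> nat \<Rightarrow> 'a :: comm_ring_1"
  assumes "\<And>i. i < n \<Longrightarrow> finite (B i)"
  shows "(\<Sum>b\<in>PiE {..<n} B. det (mat n n (\<lambda>(i, j). f i (b i) j))) =
    det (mat n n (\<lambda>(i, j). \<Sum>t\<in>B i. f i t j))"
proof -
  have perm: "i < n \<Longrightarrow> p permutes {0..<n} \<Longrightarrow> p i < n" for i p
    using permutes_in_image[of p "{0..<n}" i] by simp
  have det: "det (mat n n (\<lambda>(i, j). g i j)) =
      (\<Sum>p | p permutes {0..<n}. signof p * (\<Prod>i<n. g i (p i)))" for g :: "nat \<Rightarrow> nat \<Rightarrow> 'a"
    by (subst det_def'[of _ n]) (auto simp: atLeast0LessThan perm intro!: sum.cong prod.cong)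
  show ?thesis
    unfolding det
    by (subst sum.swap, subst prod_sum_PiE) (use assms in \<open>auto simp: sum_distrib_left\<close>)
qed

section \<open>Counting column strict fillings\<close>

text \<open>Row lengths are indexed from 0 and may be 0, so that the number of rows can be matched
  with the largest entry allowed.\<close>

definition row_shape :: "nat \<Rightarrow> (nat \<Rightarrow> nat) \<Rightarrow> (nat \<times> nat) set" where
  "row_shape n r = {(i, j). 1 \<le> i \<and> i \<le> n \<and> 1 \<le> j \<and> j \<le> r (i - 1)}"

text \<open>Reverse semistandard fillings. All comparable cells are compared, not only neighbours,
  as in \<open>P_partitions\<close>.\<close>

definition tableaux :: "nat \<Rightarrow> (nat \<times> nat) set \<Rightarrow> (nat \<times> nat \<Rightarrow> nat) set" where
  "tableaux n S = {\<sigma> \<in> S \<rightarrow>\<^sub>E {1..n}. \<forall>i j i' j'. (i, j) \<in> S \<longrightarrow> (i', j') \<in> S \<longrightarrow> i \<le> i' \<longrightarrow> j \<le> j' \<longrightarrow>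
     \<sigma> (i', j') \<le> \<sigma> (i, j) \<and> (i < i' \<longrightarrow> \<sigma> (i', j') < \<sigma> (i, j))}"

lemma tableauxD:
  assumes "\<sigma> \<in> tableaux n S" "(i, j) \<in> S" "(i', j') \<in> S" "i \<le> i'" "j \<le> j'"
  shows "\<sigma> (i', j') \<le> \<sigma> (i, j)" "i < i' \<Longrightarrow> \<sigma> (i', j') < \<sigma> (i, j)"
  using assms unfolding tableaux_def by blast+

lemma tableaux_PiE: "\<sigma> \<in> tableaux n S \<Longrightarrow> \<sigma> \<in> S \<rightarrow>\<^sub>E {1..n}"
  by (simp add: tableaux_def)

lemma tableaux_range: "\<sigma> \<in> tableaux n S \<Longrightarrow> x \<in> S \<Longrightarrow> 1 \<le> \<sigma> x \<and> \<sigma> x \<le> n"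
  using tableaux_PiE[of \<sigma> n S] PiE_mem[of \<sigma> S _ x] by fastforce

lemma tableaux_eqI:
  "\<sigma> \<in> tableaux n S \<Longrightarrow> \<tau> \<in> tableaux n S \<Longrightarrow> (\<And>x. x \<in> S \<Longrightarrow> \<sigma> x = \<tau> x) \<Longrightarrow> \<sigma> = \<tau>"
  by (rule PiE_ext[OF tableaux_PiE tableaux_PiE])

lemma finite_tableaux: "finite S \<Longrightarrow> finite (tableaux n S)"
  by (rule finite_subset[of _ "S \<rightarrow>\<^sub>E {1..n}"]) (auto simp: tableaux_def intro: finite_PiE)

lemma finite_row_shape [simp]: "finite (row_shape n r)"
  by (rule finite_subset[of _ "SIGMA i:{1..n}. {1..r (i - 1)}"]) (auto simp: row_shape_def)

text \<open>Entries start at most at \<open>n\<close> in row 1 and drop by at least 1 with every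
  step down a column.\<close>

lemma tableaux_row_bound:
  assumes \<sigma>: "\<sigma> \<in> tableaux n S"
    and down: "\<And>i j i'. (i, j) \<in> S \<Longrightarrow> 1 \<le> i' \<Longrightarrow> i' \<le> i \<Longrightarrow> (i', j) \<in> S"
    and "(i, j) \<in> S" "1 \<le> i"
  shows "\<sigma> (i, j) + i \<le> Suc n"
  using assms(4,3)
proof (induction i rule: dec_induct)
  case base
  thus ?case using tableaux_range[OF \<sigma>] by fastforce
next
  case (step i)
  have "(i, j) \<in> S"
    using down[OF step.prems, of i] step.hyps by simp
  thus ?case
    using step tableauxD(2)[OF \<sigma> _ step.prems, of i j] by fastforce
qed

text \<open>Deleting the entries 1 and lowering the others by 1 leaves a filling of a shape
  \<open>b\<close>. Row \<open>Suc n\<close> can only contain 1, so \<open>b\<close> has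
  \<open>n\<close> rows, and since a column contains at most one 1, \<open>b i\<close> lies between
  \<open>r (Suc i)\<close> and \<open>r i\<close>.\<close>

lemma card_tableaux_Suc:
  assumes anti: "\<And>i k. i \<le> k \<Longrightarrow> k \<le> n \<Longrightarrow> r k \<le> r i"
  shows "card (tableaux (Suc n) (row_shape (Suc n) r)) =
    (\<Sum>b\<in>PiE {..<n} (\<lambda>i. {r (Suc i)..r i}). card (tableaux n (row_shape n b)))"
proof -
  define B where "B = PiE {..<n} (\<lambda>i. {r (Suc i)..r i})"
  define S where "S = row_shape (Suc n) r"
  \<comment> \<open>\<open>F\<close> is the inverse operation: raise the entries inside
    \<open>b\<close> by 1 and put 1 on the rest of \<open>S\<close>.\<close>
  define F where "F = (\<lambda>(b, \<tau>). \<lambda>x\<in>S. if x \<in> row_shape n b then Suc (\<tau> x) else 1)"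
  have bB: "r (Suc i) \<le> b i" "b i \<le> r i" if "b \<in> B" "i < n" for b i
    using that PiE_mem[of b "{..<n}" _ i] by (auto simp: B_def)
  have sub: "x \<in> S" if "b \<in> B" "x \<in> row_shape n b" for b x
    using that bB[of b "fst x - 1"] by (cases x; cases "fst x") (auto simp: S_def row_shape_def)
  \<comment> \<open>A cell of \<open>S\<close> with another one below it and weakly to its right
    lies in the inner shape, because \<open>r i \<le> b (i - 1)\<close>. This keeps the added
    entries 1 from violating strictness.\<close>
  have above: "(i, j) \<in> row_shape n b"
    if "b \<in> B" "(i, j) \<in> S" "(i', j') \<in> S" "i < i'" "j \<le> j'" for b i j i' j'
  proof -
    have "i - 1 < n" "Suc (i - 1) = i" "i \<le> i' - 1" "i' - 1 \<le> n"
      using that by (auto simp: S_def row_shape_def)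
    thus ?thesis
      using that bB[of b "i - 1"] anti[of i "i' - 1"] by (auto simp: S_def row_shape_def)
  qed
  have down: "(i, j) \<in> row_shape n b"
    if "b \<in> B" "(i, j) \<in> S" "(i', j') \<in> row_shape n b" "i \<le> i'" "j \<le> j'" for b i j i' j'
  proof (cases "i = i'")
    case False
    thus ?thesis using that above[OF that(1,2) sub[OF that(1,3)]] by simp
  qed (use that in \<open>auto simp: row_shape_def S_def\<close>)
  \<comment> \<open>The inner shape can be read off the filling, which yields injectivity of
    \<open>F\<close>.\<close>
  have level: "row_shape n b = {x \<in> S. F (b, \<tau>) x \<ge> 2}" if "b \<in> B" "\<tau> \<in> tableaux n (row_shape n b)" for b \<tau>
  proof (rule Set.set_eqI)
    fix x
    show "x \<in> row_shape n b \<longleftrightarrow> x \<in> {x \<in> S. F (b, \<tau>) x \<ge> 2}"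
      using sub[OF that(1), of x] tableaux_range[OF that(2), of x] by (auto simp: F_def)
  qed
  have "bij_betw F (SIGMA b:B. tableaux n (row_shape n b)) (tableaux (Suc n) S)"
    unfolding bij_betw_def
  proof (intro conjI subset_antisym subsetI)
    show "inj_on F (SIGMA b:B. tableaux n (row_shape n b))"
    proof (rule inj_onI, clarify)
      fix b \<tau> b' \<tau>'
      assume b: "b \<in> B" "\<tau> \<in> tableaux n (row_shape n b)"
        and b': "b' \<in> B" "\<tau>' \<in> tableaux n (row_shape n b')" and eq: "F (b, \<tau>) = F (b', \<tau>')"
      have shape: "row_shape n b = row_shape n b'"
        using level[OF b] level[OF b'] eq by simp
      have "b i = b' i" if "i < n" for i
      proof -
        have *: "{j. (Suc i, j) \<in> row_shape n d} = {1..d i}" for d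
          using that by (auto simp: row_shape_def)
        have "{1..b i} = {1..b' i}"
          by (metis * shape)
        hence "card {1..b i} = card {1..b' i}" by (rule arg_cong)
        thus ?thesis by simp
      qed
      hence "b = b'"
        using b(1) b'(1) unfolding B_def by (intro PiE_ext[of b "{..<n}" _ b']) auto
      moreover have "\<tau> = \<tau>'"
      proof (rule tableaux_eqI[OF b(2)])
        show "\<tau>' \<in> tableaux n (row_shape n b)" using b' \<open>b = b'\<close> by simp
        show "\<tau> x = \<tau>' x" if "x \<in> row_shape n b" for x
          using fun_cong[OF eq, of x] sub[OF b(1) that] that shape by (simp add: F_def)
      qed
      ultimately show "b = b' \<and> \<tau> = \<tau>'" ..
    qed
  next
    fix \<sigma> assume "\<sigma> \<in> F ` (SIGMA b:B. tableaux n (row_shape n b))"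
    then obtain b \<tau> where b: "b \<in> B" and \<tau>: "\<tau> \<in> tableaux n (row_shape n b)" and \<sigma>: "\<sigma> = F (b, \<tau>)"
      by auto
    show "\<sigma> \<in> tableaux (Suc n) S"
      unfolding tableaux_def
    proof (intro CollectI conjI allI impI)
      show "\<sigma> \<in> S \<rightarrow>\<^sub>E {1..Suc n}"
        using tableaux_range[OF \<tau>] by (auto simp: \<sigma> F_def)
      fix i j i' j' assume ij: "(i, j) \<in> S" "(i', j') \<in> S" "i \<le> i'" "j \<le> j'"
      show "\<sigma> (i', j') \<le> \<sigma> (i, j)"
        using ij down[OF b ij(1) _ ij(3,4)] tableauxD(1)[OF \<tau> _ _ ij(3,4)]
        by (auto simp: \<sigma> F_def)
      assume "i < i'"
      thus "\<sigma> (i', j') < \<sigma> (i, j)"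
        using ij above[OF b ij(1,2) _ ij(4)] tableauxD(2)[OF \<tau> _ _ ij(3,4)] tableaux_range[OF \<tau>]
        by (fastforce simp: \<sigma> F_def)
    qed
  next
    fix \<sigma> assume \<sigma>: "\<sigma> \<in> tableaux (Suc n) S"
    define b where "b = (\<lambda>i\<in>{..<n}. card {j. (Suc i, j) \<in> S \<and> \<sigma> (Suc i, j) \<ge> 2})"
    have row: "{j. (Suc i, j) \<in> S \<and> \<sigma> (Suc i, j) \<ge> 2} = {1..b i}" if "i < n" for i
    proof -
      let ?R = "{j. (Suc i, j) \<in> S \<and> \<sigma> (Suc i, j) \<ge> 2}"
      have "?R = {1..card ?R}"
      proof (rule down_set_nat_eq)
        show "finite ?R"
          by (rule finite_subset[of _ "{1..r i}"]) (auto simp: S_def row_shape_def)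
        fix j assume j: "j \<in> ?R"
        thus "1 \<le> j" by (auto simp: S_def row_shape_def)
        fix j' assume j': "1 \<le> j'" "j' \<le> j"
        hence "(Suc i, j') \<in> S" using j by (auto simp: S_def row_shape_def)
        thus "j' \<in> ?R"
          using j j' tableauxD(1)[OF \<sigma>, of "Suc i" j' "Suc i" j] by auto
      qed
      thus ?thesis using that by (simp add: b_def)
    qed
    have "r (Suc i) \<le> b i \<and> b i \<le> r i" if "i < n" for i
    proof
      have "{1..b i} \<subseteq> {1..r i}"
        using row[OF that] by (auto simp: S_def row_shape_def set_eq_iff)
      thus "b i \<le> r i" by auto
      \<comment> \<open>A cell with a cell directly below it has an entry exceeding one that is at
        least 1.\<close>
      have "{1..r (Suc i)} \<subseteq> {1..b i}"
      proof
        fix j assume "j \<in> {1..r (Suc i)}"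
        hence S: "(Suc (Suc i), j) \<in> S" "(Suc i, j) \<in> S"
          using that anti[of i "Suc i"] by (auto simp: S_def row_shape_def)
        hence "\<sigma> (Suc i, j) \<ge> 2"
          using tableauxD(2)[OF \<sigma> S(2,1)] tableaux_range[OF \<sigma> S(1)] by simp
        thus "j \<in> {1..b i}" using S row[OF that] by blast
      qed
      thus "r (Suc i) \<le> b i" by auto
    qed
    hence b: "b \<in> B"
      by (auto simp: B_def b_def)
    \<comment> \<open>For row \<open>Suc n\<close> this bounds the entries by 1, so entries of at
      least 2 lie in the first \<open>n\<close> rows.\<close>
    have bound: "\<sigma> (i, j) + i \<le> Suc (Suc n)" if "(i, j) \<in> S" for i j
    proof (rule tableaux_row_bound[OF \<sigma> _ that])
      show "(i', j) \<in> S" if "(i, j) \<in> S" "1 \<le> i'" "i' \<le> i" for i j i'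
      proof -
        have "i' - 1 \<le> i - 1" "i - 1 \<le> n" using that by (auto simp: S_def row_shape_def)
        thus ?thesis using that anti[of "i' - 1" "i - 1"] by (auto simp: S_def row_shape_def)
      qed
      show "1 \<le> i" using that by (simp add: S_def row_shape_def)
    qed
    have mem: "x \<in> row_shape n b \<longleftrightarrow> x \<in> S \<and> \<sigma> x \<ge> 2" for x
    proof (cases x)
      case (Pair i j)
      show ?thesis
      proof (cases "1 \<le> i \<and> i \<le> n")
        case True
        hence "i - 1 < n" "Suc (i - 1) = i" by auto
        thus ?thesis using True row[of "i - 1"] Pair by (auto simp: row_shape_def set_eq_iff)
      next
        case False
        have "\<not> (x \<in> S \<and> \<sigma> x \<ge> 2)"
          using False bound[of i j] Pair by (auto simp: S_def row_shape_def)
        thus ?thesis using False Pair by (auto simp: row_shape_def)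
      qed
    qed
    define \<tau> where "\<tau> = (\<lambda>x\<in>row_shape n b. \<sigma> x - 1)"
    have \<tau>: "\<tau> \<in> tableaux n (row_shape n b)"
      unfolding tableaux_def
    proof (intro CollectI conjI allI impI)
      show "\<tau> \<in> row_shape n b \<rightarrow>\<^sub>E {1..n}"
        using tableaux_range[OF \<sigma>] by (fastforce simp: \<tau>_def mem)
      fix i j i' j' assume ij: "(i, j) \<in> row_shape n b" "(i', j') \<in> row_shape n b" "i \<le> i'" "j \<le> j'"
      show "\<tau> (i', j') \<le> \<tau> (i, j)"
        using ij tableauxD(1)[OF \<sigma> _ _ ij(3,4)] by (auto simp: \<tau>_def mem)
      assume "i < i'"
      thus "\<tau> (i', j') < \<tau> (i, j)"
        using ij tableauxD(2)[OF \<sigma> _ _ ij(3,4)] by (fastforce simp: \<tau>_def mem)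
    qed
    have "\<sigma> = F (b, \<tau>)"
    proof
      fix x
      show "\<sigma> x = F (b, \<tau>) x"
      proof (cases "x \<in> S")
        case True
        thus ?thesis using tableaux_range[OF \<sigma> True] mem[of x] by (auto simp: F_def \<tau>_def)
      next
        case False
        thus ?thesis using PiE_arb[OF tableaux_PiE[OF \<sigma>]] by (simp add: F_def)
      qed
    qed
    thus "\<sigma> \<in> F ` (SIGMA b:B. tableaux n (row_shape n b))"
      using b \<tau> by blast
  qed
  hence "card (tableaux (Suc n) S) = card (SIGMA b:B. tableaux n (row_shape n b))"
    by (simp add: bij_betw_same_card)
  also have "\<dots> = (\<Sum>b\<in>B. card (tableaux n (row_shape n b)))"
    by (rule card_SigmaI) (auto simp: B_def finite_tableaux intro!: finite_PiE)
  finally show ?thesis by (simp add: S_def B_def)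
qed

section \<open>Determinant and product formula for the number of fillings\<close>

text \<open>Telescoping by Pascal's rule. The offset \<open>d\<close> accommodates the row shifts of
  the determinant formula.\<close>

lemma sum_gbinomial_interval:
  assumes "a \<le> b"
  shows "(\<Sum>t\<in>{a..b}. real (t + d) gchoose k) =
    (real (b + Suc d) gchoose Suc k) - (real (a + d) gchoose Suc k)"
  using assms
proof (induction b rule: dec_induct)
  case base
  show ?case using gbinomial_Suc_Suc[of "real (a + d)" k] by (simp add: add_ac)
next
  case (step b)
  show ?case
    using step gbinomial_Suc_Suc[of "real (b + Suc d)" k] by (simp add: add_ac)
qed

text \<open>Induction by removing the entries 1: multilinearity moves the sum over \<open>b\<close>
  into the rows, the sums telescope to differences of consecutive rows, and
  \<open>det_binomial_mat_diff\<close> turns these into the larger determinant.\<close>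

lemma card_tableaux_det:
  assumes "\<And>i k. i \<le> k \<Longrightarrow> k < n \<Longrightarrow> r k \<le> r i"
  shows "real (card (tableaux n (row_shape n r))) = det (binomial_mat n (\<lambda>i. real (r i + (n - 1 - i))))"
  using assms
proof (induction n arbitrary: r)
  case 0
  have "tableaux 0 (row_shape 0 r) = {\<lambda>_. undefined}"
    by (auto simp: tableaux_def row_shape_def)
  thus ?case by (simp add: binomial_mat_def)
next
  case (Suc n)
  define B where "B = (\<lambda>i. {r (Suc i)..r i})"
  define f where "f i t j = real (t + (n - 1 - i)) gchoose (n - 1 - j)" for i t j
  have "real (card (tableaux (Suc n) (row_shape (Suc n) r))) =
      (\<Sum>b\<in>PiE {..<n} B. real (card (tableaux n (row_shape n b))))"
    using Suc.prems unfolding B_def by (subst card_tableaux_Suc) auto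
  also have "\<dots> = (\<Sum>b\<in>PiE {..<n} B. det (mat n n (\<lambda>(i, j). f i (b i) j)))"
  proof (intro sum.cong refl)
    fix b assume b: "b \<in> PiE {..<n} B"
    have b': "r (Suc i) \<le> b i" "b i \<le> r i" if "i < n" for i
      using that PiE_mem[OF b, of i] by (auto simp: B_def)
    have "b k \<le> b i" if "i \<le> k" "k < n" for i k
      using that b'[of i] b'[of k] Suc.prems[of "Suc i" k] by (cases "i = k") auto
    hence "real (card (tableaux n (row_shape n b))) = det (binomial_mat n (\<lambda>i. real (b i + (n - 1 - i))))"
      by (rule Suc.IH)
    thus "real (card (tableaux n (row_shape n b))) = det (mat n n (\<lambda>(i, j). f i (b i) j))"
      by (simp add: binomial_mat_def f_def)
  qed
  also have "\<dots> = det (mat n n (\<lambda>(i, j). \<Sum>t\<in>B i. f i t j))"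
    by (rule sum_det_rows_PiE) (simp add: B_def)
  \<comment> \<open>The lower end of the interval yields \<open>r (Suc i) + (n - 1 - i)\<close>,
    which is exactly the shifted length of the next row.\<close>
  also have "mat n n (\<lambda>(i, j). \<Sum>t\<in>B i. f i t j) =
      mat n n (\<lambda>(i, j). (real (r i + (Suc n - 1 - i)) gchoose (n - j)) -
        (real (r (Suc i) + (Suc n - 1 - Suc i)) gchoose (n - j)))"
  proof (rule cong_mat, simp, simp, clarify)
    fix i j assume ij: "i < n" "j < n"
    have "r (Suc i) \<le> r i" using Suc.prems[of i "Suc i"] ij by simp
    moreover have "Suc (n - 1 - i) = n - i" "Suc (n - 1 - j) = n - j" using ij by auto
    ultimately show "(\<Sum>t\<in>B i. f i t j) = (real (r i + (Suc n - 1 - i)) gchoose (n - j)) -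
        (real (r (Suc i) + (Suc n - 1 - Suc i)) gchoose (n - j))"
      using sum_gbinomial_interval[of "r (Suc i)" "r i" "n - 1 - i" "n - 1 - j"]
      by (simp add: B_def f_def)
  qed
  also have "det \<dots> = det (binomial_mat (Suc n) (\<lambda>i. real (r i + (Suc n - 1 - i))))"
    by (rule det_binomial_mat_diff[symmetric])
  finally show ?case .
qed

text \<open>The Vandermonde product of the shifted row lengths \<open>r i - i\<close>, that is, the
  numerator of Weyl's dimension formula.\<close>

definition weyl_prod :: "nat \<Rightarrow> (nat \<Rightarrow> nat) \<Rightarrow> real" where
  "weyl_prod n r = (\<Prod>j<n. \<Prod>i<j. (real (r i) - real i) - (real (r j) - real j))"

lemma weyl_prod_pos:
  assumes "\<And>i k. i \<le> k \<Longrightarrow> k < n \<Longrightarrow> r k \<le> r i"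
  shows "weyl_prod n r > 0"
  unfolding weyl_prod_def
proof (intro prod_pos ballI)
  fix j i assume "j \<in> {..<n}" "i \<in> {..<j}"
  thus "0 < real (r i) - real i - (real (r j) - real j)"
    using assms[of i j] by simp
qed

lemma card_tableaux_weyl_prod:
  assumes anti: "\<And>i k. i \<le> k \<Longrightarrow> k < n \<Longrightarrow> r k \<le> r i"
  shows "real (card (tableaux n (row_shape n r))) * (\<Prod>j<n. fact j) = weyl_prod n r"
proof -
  define x where "x = (\<lambda>i. real (r i + (n - 1 - i)))"
  have card: "real (card (tableaux n (row_shape n r))) = det (binomial_mat n x)"
    unfolding x_def by (rule card_tableaux_det[OF anti])
  have "x i > x k" if "i < k" "k < n" for i k
    using that anti[of i k] by (simp add: x_def)
  hence "inj_on x {..<n}"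
    by (intro linorder_inj_onI) fastforce+
  hence "real (card (tableaux n (row_shape n r))) * (\<Prod>j<n. fact j) = (\<Prod>j<n. \<Prod>i<j. x i - x j)"
    unfolding card by (rule det_binomial_mat)
  also have "\<dots> = weyl_prod n r"
    unfolding weyl_prod_def by (intro prod.cong refl) (auto simp: x_def of_nat_diff)
  finally show ?thesis .
qed

text \<open>Passing from \<open>n\<close> to \<open>Suc n\<close> adds an empty row. The new factors
  for \<open>r\<close> and \<open>s\<close> agree except at row \<open>p\<close>, where they are
  \<open>n + 1 + c\<close> and \<open>n + c\<close>, so the quotients telescope from
  \<open>l\<close> on.\<close>

lemma weyl_prod_remove_cell:
  assumes "p < l" "l \<le> n" "r p \<ge> 1" and zero: "\<And>i. l \<le> i \<Longrightarrow> r i = 0"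
    and s: "s = r(p := r p - 1)" and c: "c = real (r p) - 1 - real p"
  shows "weyl_prod n r * (weyl_prod l s * (l + c)) = weyl_prod l r * (weyl_prod n s * (n + c))"
  using \<open>l \<le> n\<close>
proof (induction n rule: dec_induct)
  case (step n)
  define R where "R = (\<Prod>i\<in>{..<n} - {p}. real (r i) - real i + real n)"
  have pn: "p < n" using \<open>p < l\<close> step.hyps by simp
  have r: "weyl_prod (Suc n) r = weyl_prod n r * ((n + 1 + c) * R)"
  proof -
    have "(\<Prod>i<n. (real (r i) - real i) - (real (r n) - real n)) =
        (n + 1 + c) * R"
      unfolding R_def using pn step.hyps
      by (subst prod.remove[of _ p]) (auto simp: zero c algebra_simps)
    thus ?thesis by (simp add: weyl_prod_def)
  qed
  have s: "weyl_prod (Suc n) s = weyl_prod n s * ((n + c) * R)"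
  proof -
    have "(\<Prod>i<n. (real (s i) - real i) - (real (s n) - real n)) =
        (n + c) * R"
      unfolding R_def using pn step.hyps \<open>r p \<ge> 1\<close>
      by (subst prod.remove[of _ p]) (auto simp: zero c s algebra_simps of_nat_diff)
    thus ?thesis by (simp add: weyl_prod_def)
  qed
  have "weyl_prod (Suc n) r * (weyl_prod l s * (l + c)) =
      (weyl_prod n r * (weyl_prod l s * (l + c))) * ((n + 1 + c) * R)"
    by (simp add: r)
  also have "\<dots> = weyl_prod l r * (weyl_prod (Suc n) s * (Suc n + c))"
    unfolding step.IH s by (simp add: algebra_simps)
  finally show ?case .
qed simp

section \<open>Interlacing\<close>

lemma root_poly_distinct:
  assumes "distinct xs"
  shows "root_poly xs = (\<Prod>x\<in>set xs. [:- x, 1:])"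
  using assms by (simp add: root_poly_def prod.distinct_set_conv_list)

lemma root_poly_filter:
  assumes "distinct xs"
  shows "root_poly xs = [:- x, 1:] ^ of_bool (x \<in> set xs) * root_poly (filter (\<lambda>y. y \<noteq> x) xs)"
proof (cases "x \<in> set xs")
  case True
  have "set (filter (\<lambda>y. y \<noteq> x) xs) = set xs - {x}" by auto
  thus ?thesis
    using assms True by (simp add: root_poly_distinct prod.remove del: mult_pCons_left set_filter)
next
  case False
  hence "filter (\<lambda>y. y \<noteq> x) xs = xs" by (intro filter_True) auto
  thus ?thesis using False by simp
qed

lemma poly_root_poly_nth: "poly (root_poly rs) t = (\<Prod>j<length rs. t - rs ! j)"
  by (simp add: poly_root_poly prod.list_conv_set_nth atLeast0LessThan)

text \<open>Among the factors of the derivative at \<open>rs ! i\<close>, exactly the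
  \<open>length rs - 1 - i\<close> belonging to larger zeros are negative.\<close>

lemma sign_pderiv_root_poly:
  assumes rs: "sorted_wrt (<) rs" and i: "i < length rs"
  shows "(-1) ^ (length rs - 1 - i) * poly (pderiv (root_poly rs)) (rs ! i) > 0"
proof -
  have less: "rs ! j < rs ! k" if "j < k" "k < length rs" for j k
    using rs that by (simp add: sorted_wrt_iff_nth_less)
  have "distinct rs" using rs by (simp add: strict_sorted_iff)
  define f where "f j = rs ! i - rs ! j" for j
  have "{..<length rs} - {i} = {..<i} \<union> {i<..<length rs}" using i by auto
  hence "poly (pderiv (root_poly rs)) (rs ! i) = prod f ({..<i} \<union> {i<..<length rs})"
    using poly_pderiv_root_poly[OF \<open>distinct rs\<close> i] by (simp add: f_def)
  also have "\<dots> = prod f {..<i} * prod f {i<..<length rs}"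
    by (rule prod.union_disjoint) auto
  finally have eq: "poly (pderiv (root_poly rs)) (rs ! i) = prod f {..<i} * prod f {i<..<length rs}" .
  have "prod f {..<i} > 0"
    by (rule prod_pos) (use less i in \<open>auto simp: f_def\<close>)
  moreover have "(-1) ^ card {i<..<length rs} * prod f {i<..<length rs} > 0"
    by (rule prod_neg_sign) (use less i in \<open>auto simp: f_def\<close>)
  ultimately have "prod f {..<i} * ((-1) ^ card {i<..<length rs} * prod f {i<..<length rs}) > 0"
    by (rule mult_pos_pos)
  thus ?thesis unfolding eq by (simp add: mult_ac)
qed

text \<open>At a zero r of G the image Q takes the value r (1 + r) G'(r), whose sign alternates
  along the zeros; at -1 and 0 it takes the values (c - d) G(-1) and c G(0), which continue the
  alternation or vanish. This gives one zero of Q for each gap.\<close>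

lemma content_op_interlacing:
  fixes rs :: "real list" and c d :: real
  assumes rs: "sorted_wrt (<) rs" and range: "\<And>r. r \<in> set rs \<Longrightarrow> -1 < r \<and> r < 0"
    and c: "0 \<le> c" "c \<le> d" "0 < d"
  obtains qs where
    "content_op c d (root_poly rs) = smult (length rs + d) (root_poly qs)"
    "length qs = Suc (length rs)" "sorted_wrt (<) qs"
    "\<And>i. i < length rs \<Longrightarrow> qs ! i < rs ! i \<and> rs ! i < qs ! Suc i"
    "\<And>q. q \<in> set qs \<Longrightarrow> -1 \<le> q \<and> q \<le> 0"
    "-1 \<in> set qs \<longleftrightarrow> c = d" "0 \<in> set qs \<longleftrightarrow> c = 0"
proof -
  define m where "m = length rs"
  define G where "G = root_poly rs"
  define Q where "Q = content_op c d G"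
  \<comment> \<open>The ends of the \<open>m + 1\<close> gaps: -1, the zeros in order, and
    0.\<close>
  define t where "t i = (if i = 0 then -1 else if i \<le> m then rs ! (i - 1) else 0)" for i
  have less: "rs ! j < rs ! k" if "j < k" "k < m" for j k
    using rs that by (simp add: sorted_wrt_iff_nth_less m_def)
  have nth: "-1 < rs ! i" "rs ! i < 0" if "i < m" for i
    using range[of "rs ! i"] that by (auto simp: m_def)
  have t_less: "t i < t (Suc i)" if "i \<le> m" for i
    using that less[of "i - 1" i] nth[of i] nth[of "i - 1"] by (auto simp: t_def)
  have poly_Q: "poly Q x = x * (1 + x) * poly (pderiv G) x + (c + d * x) * poly G x" for x
    by (simp add: Q_def content_op_def algebra_simps)
  \<comment> \<open>Normalised by the expected alternating sign, the values become positive, apart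
    from possible zeros at the two ends.\<close>
  define s where "s i = (-1) ^ (Suc m - i) * poly Q (t i)" for i
  have s_mid: "s i > 0" if "1 \<le> i" "i \<le> m" for i
  proof -
    have i: "i - 1 < length rs" "Suc m - i = Suc (length rs - 1 - (i - 1))" "t i = rs ! (i - 1)"
      using that by (auto simp: t_def m_def)
    define y where "y = rs ! (i - 1)"
    have "poly G y = (\<Prod>j<length rs. y - rs ! j)" by (simp add: G_def poly_root_poly_nth)
    also have "\<dots> = 0" using i by (auto simp: y_def prod_zero_iff)
    finally have s_eq: "s i = (- y * (1 + y)) * ((-1) ^ (length rs - 1 - (i - 1)) * poly (pderiv G) y)"
      unfolding s_def i(2,3) poly_Q y_def[symmetric] by (simp add: algebra_simps)
    have 1: "- y * (1 + y) > 0"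
      using nth[of "i - 1"] i(1) by (simp add: y_def m_def mult_neg_pos)
    have 2: "(-1) ^ (length rs - 1 - (i - 1)) * poly (pderiv G) y > 0"
      unfolding G_def y_def by (rule sign_pderiv_root_poly[OF rs i(1)])
    show ?thesis unfolding s_eq by (rule mult_pos_pos[OF 1 2])
  qed
  have "(-1) ^ card {..<m} * (\<Prod>j<m. -1 - rs ! j) > 0"
    by (rule prod_neg_sign) (use nth in auto)
  hence G_left: "(-1) ^ m * poly G (-1) > 0"
    by (simp add: G_def poly_root_poly_nth m_def)
  have s_left: "s 0 = (d - c) * ((-1) ^ m * poly G (-1))"
    by (simp add: s_def t_def poly_Q algebra_simps)
  have "(\<Prod>j<m. 0 - rs ! j) > 0"
    by (rule prod_pos) (use nth in auto)
  hence G_right: "poly G 0 > 0"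
    by (simp add: G_def poly_root_poly_nth m_def)
  have s_right: "s (Suc m) = c * poly G 0"
    by (simp add: s_def t_def poly_Q)
  have s_pos: "s i > 0" if "i \<le> Suc m" "i = 0 \<Longrightarrow> c \<noteq> d" "i = Suc m \<Longrightarrow> c \<noteq> 0" for i
  proof -
    have "i = 0 \<or> 1 \<le> i \<and> i \<le> m \<or> i = Suc m" using that(1) by linarith
    then consider "i = 0" | "1 \<le> i" "i \<le> m" | "i = Suc m" by blast
    thus ?thesis
    proof cases
      case 1
      thus ?thesis using that(2) c G_left s_left by simp
    next
      case 2
      thus ?thesis by (rule s_mid)
    next
      case 3
      thus ?thesis using that(3) c G_right s_right by simp
    qed
  qed
  have "\<exists>q. poly Q q = 0 \<and> t i \<le> q \<and> q \<le> t (Suc i) \<and> (q = t i \<longleftrightarrow> i = 0 \<and> c = d) \<and>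
      (q = t (Suc i) \<longleftrightarrow> i = m \<and> c = 0)" if i: "i \<le> m" for i
  proof -
    \<comment> \<open>In the degenerate cases the endpoint itself serves as the zero. For
      \<open>m = 0\<close> both would concern the same gap, but \<open>0 < d\<close> excludes that
      they occur together.\<close>
    consider (left) "i = 0" "c = d" | (right) "i = m" "c = 0" | (mid) "i = 0 \<Longrightarrow> c \<noteq> d" "i = m \<Longrightarrow> c \<noteq> 0"
      by blast
    thus ?thesis
    proof cases
      case left
      have "poly Q (t i) = 0" using left by (simp add: t_def poly_Q)
      thus ?thesis using left c t_less[OF i] by (intro exI[of _ "t i"]) auto
    next
      case right
      have "poly Q (t (Suc i)) = 0" using right by (simp add: t_def poly_Q)
      thus ?thesis using right c t_less[OF i] by (intro exI[of _ "t (Suc i)"]) auto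
    next
      case mid
      have "0 < s i * s (Suc i)"
        using s_pos[of i] s_pos[of "Suc i"] mid i by (intro mult_pos_pos) auto
      also have "s i * s (Suc i) = - ((-1) ^ (Suc m - Suc i) * (-1) ^ (Suc m - Suc i)) * (poly Q (t i) * poly Q (t (Suc i)))"
        using i by (simp add: s_def Suc_diff_le)
      also have "(-1 :: real) ^ (Suc m - Suc i) * (-1) ^ (Suc m - Suc i) = 1"
        by (simp flip: power_add)
      finally have "poly Q (t i) * poly Q (t (Suc i)) < 0" by simp
      then obtain q where "t i < q" "q < t (Suc i)" "poly Q q = 0"
        using poly_IVT[OF t_less[OF i]] by blast
      thus ?thesis using mid by (intro exI[of _ q]) auto
    qed
  qed
  hence "\<forall>i\<in>{..m}. \<exists>q. poly Q q = 0 \<and> t i \<le> q \<and> q \<le> t (Suc i) \<and> (q = t i \<longleftrightarrow> i = 0 \<and> c = d) \<and>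
      (q = t (Suc i) \<longleftrightarrow> i = m \<and> c = 0)" by simp
  then obtain q where "\<forall>i\<in>{..m}. poly Q (q i) = 0 \<and> t i \<le> q i \<and> q i \<le> t (Suc i) \<and>
      (q i = t i \<longleftrightarrow> i = 0 \<and> c = d) \<and> (q i = t (Suc i) \<longleftrightarrow> i = m \<and> c = 0)"
    by (rule bchoice[THEN exE])
  hence q: "poly Q (q i) = 0" "t i \<le> q i" "q i \<le> t (Suc i)" "q i = t i \<longleftrightarrow> i = 0 \<and> c = d"
    "q i = t (Suc i) \<longleftrightarrow> i = m \<and> c = 0" if "i \<le> m" for i
    using that by simp_all
  define qs where "qs = map q [0..<Suc m]"
  have len: "length qs = Suc m" by (simp add: qs_def)
  have qs_nth: "qs ! i = q i" if "i \<le> m" for i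
    using that by (simp add: qs_def del: upt_Suc)
  \<comment> \<open>Endpoints are attained only at -1 and 0, hence never at a zero in
    \<open>rs\<close>.\<close>
  have inter: "q i < rs ! i \<and> rs ! i < q (Suc i)" if "i < m" for i
  proof -
    have "t (Suc i) = rs ! i" using that by (simp add: t_def)
    thus ?thesis
      using q(3,5)[of i] q(2,4)[of "Suc i"] that by (auto simp: order.strict_iff_order)
  qed
  have sorted: "sorted_wrt (<) qs"
    using inter by (subst sorted_wrt_iff_nth_Suc_transp)
      (auto simp: len qs_nth transp_def intro: less_trans)
  have q_mono: "q i < q k" if "i < k" "k \<le> m" for i k
    using sorted that by (simp add: sorted_wrt_iff_nth_less len qs_nth flip: qs_nth)
  have set_qs: "set qs = q ` {..m}"
    by (auto simp: qs_def simp del: upt_Suc)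
  have q_lower: "-1 \<le> q i" if "i \<le> m" for i
    using q_mono[of 0 i] q(2)[of 0] that by (cases "i = 0") (auto simp: t_def)
  have q_upper: "q i \<le> 0" if "i \<le> m" for i
    using q_mono[of i m] q(3)[of m] that by (cases "i = m") (auto simp: t_def)
  have left: "-1 \<in> set qs \<longleftrightarrow> c = d"
  proof -
    have "q i = -1 \<longleftrightarrow> i = 0 \<and> c = d" if "i \<le> m" for i
      using q_mono[of 0 i] q_lower[of 0] q(4)[of 0] that by (cases "i = 0") (auto simp: t_def)
    thus ?thesis unfolding set_qs by (force simp: eq_commute[of "-1"])
  qed
  have right: "0 \<in> set qs \<longleftrightarrow> c = 0"
  proof -
    have "q i = 0 \<longleftrightarrow> i = m \<and> c = 0" if "i \<le> m" for i
      using q_mono[of i m] q_upper[of m] q(5)[of m] that by (cases "i = m") (auto simp: t_def)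
    thus ?thesis unfolding set_qs by (force simp: eq_commute[of "0"])
  qed
  have dist: "distinct qs" using sorted by (simp add: strict_sorted_iff)
  have card: "card (set qs) = Suc m" using distinct_card[OF dist] len by simp
  have coeff_G: "coeff G m = 1" "\<And>k. k > m \<Longrightarrow> coeff G k = 0"
    using lead_coeff_root_poly[of rs] by (auto simp: G_def m_def coeff_eq_0)
  \<comment> \<open>The \<open>m + 1\<close> distinct zeros exhaust the degree bound
    \<open>m + 1\<close>.\<close>
  have "Q = smult (coeff Q (card (set qs))) (\<Prod>r\<in>set qs. [:- r, 1:])"
  proof (rule poly_eq_smult_prod_roots)
    show "degree Q \<le> card (set qs)"
      unfolding card by (rule degree_le) (auto simp: Q_def coeff_content_op coeff_G)
  qed (use q(1) in \<open>auto simp: set_qs\<close>)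
  moreover have "coeff Q (Suc m) = m + d"
    by (simp add: Q_def coeff_content_op coeff_G)
  ultimately have "Q = smult (m + d) (root_poly qs)"
    by (simp add: card root_poly_distinct[OF dist])
  thus ?thesis
    using len sorted inter left right q_lower q_upper
    by (intro that[of qs]) (auto simp: Q_def G_def m_def qs_nth[unfolded m_def] set_qs[unfolded m_def])
qed

section \<open>Zeros at the endpoints 0 and -1\<close>

lemma content_op_mult_linear:
  "content_op c d ([:t, 1:] * F) = [:t, 1:] * content_op c d F + [:0, 1, 1:] * F"
proof -
  have "pderiv ([:t, 1:] * F) = [:t, 1:] * pderiv F + F"
    unfolding pderiv_mult by (simp add: pderiv_pCons)
  thus ?thesis
    unfolding content_op_def by (simp only: distrib_left distrib_right mult_ac add_ac)
qed

lemma content_op_mult_X: "content_op c d ([:0, 1:] * F) = [:0, 1:] * content_op (c + 1) (d + 1) F"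
  unfolding content_op_mult_linear by (simp add: content_op_def smult_add_left)

lemma content_op_mult_X1: "content_op c d ([:1, 1:] * F) = [:1, 1:] * content_op c (d + 1) F"
  unfolding content_op_mult_linear by (simp add: content_op_def smult_add_left add_ac)

text \<open>The term left by the product rule is x (1 + x) F. Taking out x leaves (1 + x) F, which
  adds 1 to \<open>c\<close> and \<open>d\<close>; taking out 1 + x leaves x F, which adds 1 to
  \<open>d\<close> only.\<close>

lemma content_op_mult_powers:
  "content_op c d ([:1, 1:] ^ b * ([:0, 1:] ^ a * F)) =
    [:1, 1:] ^ b * ([:0, 1:] ^ a * content_op (c + a) (d + a + b) F)"
proof -
  have "content_op c d ([:0, 1:] ^ a * F) = [:0, 1:] ^ a * content_op (c + a) (d + a) F" for c d
    by (induction a arbitrary: c d)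
      (simp_all add: mult.assoc content_op_mult_X add_ac del: mult_pCons_left)
  moreover have "content_op c d ([:1, 1:] ^ b * H) = [:1, 1:] ^ b * content_op c (d + b) H" for d H
    by (induction b arbitrary: d)
      (simp_all add: mult.assoc content_op_mult_X1 add_ac del: mult_pCons_left)
  ultimately show ?thesis by (simp add: add_ac)
qed

lemma content_op_smult: "content_op c d (smult k F) = smult k (content_op c d F)"
  by (simp add: content_op_def pderiv_smult smult_add_right)

text \<open>The induction invariant. As the interval is open, \<open>a\<close> and \<open>b\<close>
  are the exact orders of the zeros at 0 and -1.\<close>

definition simple_zeros_form :: "nat \<Rightarrow> nat \<Rightarrow> real poly \<Rightarrow> bool" where
  "simple_zeros_form a b F \<longleftrightarrow> (\<exists>k rs. k \<noteq> 0 \<and> sorted_wrt (<) rs \<and> (\<forall>r\<in>set rs. -1 < r \<and> r < 0) \<and>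
     F = smult k ([:1, 1:] ^ b * ([:0, 1:] ^ a * root_poly rs)))"

lemma root_poly_pad:
  "[:1, 1:] ^ b * ([:0, 1:] ^ a * root_poly rs) = root_poly (replicate b (-1) @ rs @ replicate a 0)"
  by (simp add: mult_ac)

text \<open>With the endpoint powers pulled out, the parameters are \<open>c + a\<close> and
  \<open>1 + a + b\<close>, and the bounds on \<open>c\<close> become those of
  \<open>content_op_interlacing\<close>. An extreme value of \<open>c\<close> sends a zero to an
  endpoint and raises its order there.\<close>

lemma simple_zeros_form_content_op:
  assumes F: "simple_zeros_form a b F" and F': "smult K F' = content_op c 1 F" "K \<noteq> 0"
    and c: "- real a \<le> c" "c \<le> real b + 1"
  shows "interlaces F F'"
    "simple_zeros_form (a + of_bool (c = - real a)) (b + of_bool (c = real b + 1)) F'"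
proof -
  obtain k rs where k: "k \<noteq> 0" and rs: "sorted_wrt (<) rs" "\<And>r. r \<in> set rs \<Longrightarrow> -1 < r \<and> r < 0"
    and F_eq: "F = smult k ([:1, 1:] ^ b * ([:0, 1:] ^ a * root_poly rs))"
    using F unfolding simple_zeros_form_def by blast
  define d where "d = 1 + real a + real b"
  obtain qs where qs: "content_op (c + a) d (root_poly rs) = smult (length rs + d) (root_poly qs)"
    "length qs = Suc (length rs)" "sorted_wrt (<) qs"
    "\<And>i. i < length rs \<Longrightarrow> qs ! i < rs ! i \<and> rs ! i < qs ! Suc i"
    "\<And>q. q \<in> set qs \<Longrightarrow> -1 \<le> q \<and> q \<le> 0"
    "-1 \<in> set qs \<longleftrightarrow> c + a = d" "0 \<in> set qs \<longleftrightarrow> c + a = 0"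
    using content_op_interlacing[of rs "c + a" d] rs c by (auto simp: d_def)
  define k' where "k' = k * (length rs + d) / K"
  have k': "k' \<noteq> 0" using k F'(2) by (simp add: k'_def d_def add_eq_0_iff_both_eq_0)
  have "smult K F' = smult (k * (length rs + d)) ([:1, 1:] ^ b * ([:0, 1:] ^ a * root_poly qs))"
    unfolding F'(1) F_eq content_op_smult content_op_mult_powers d_def[symmetric] qs(1)
    by (simp only: mult_smult_right smult_smult)
  also have "k * (length rs + d) = K * k'"
    using F'(2) by (simp add: k'_def)
  finally have "smult K F' = smult K (smult k' ([:1, 1:] ^ b * ([:0, 1:] ^ a * root_poly qs)))"
    by simp
  hence F'_eq: "F' = smult k' ([:1, 1:] ^ b * ([:0, 1:] ^ a * root_poly qs))"
    using F'(2) by (metis smult_smult smult_1_left left_inverse)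
  show "interlaces F F'"
    unfolding F_eq F'_eq root_poly_pad
  proof (rule interlaces_root_poly[OF k k'])
    show "sorted (replicate b (-1) @ rs @ replicate a 0)"
      using rs by (auto simp: sorted_append strict_sorted_iff less_imp_le)
    show "sorted (replicate b (-1) @ qs @ replicate a 0)"
      using qs(3,5) by (auto simp: sorted_append strict_sorted_iff)
    show "length (replicate b (-1) @ qs @ replicate a (0::real)) = Suc (length (replicate b (-1) @ rs @ replicate a 0))"
      by (simp add: qs(2))
    fix i assume i: "i < length (replicate b (-1 :: real) @ rs @ replicate a 0)"
    have nth: "(replicate b x @ xs @ replicate a y) ! j =
        (if j < b then x else if j < b + length xs then xs ! (j - b) else y)"
      if "j < b + length xs + a" for j xs and x y :: real
      using that by (auto simp: nth_append)
    \<comment> \<open>These bounds settle the positions where the inner zeros meet the padding by -1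
      and 0.\<close>
    have "qs ! 0 \<ge> -1" "qs ! length rs \<le> 0"
      using qs(2) qs(5)[OF nth_mem[of 0 qs]] qs(5)[OF nth_mem[of "length rs" qs]] by auto
    moreover have "qs ! (i - b) \<le> rs ! (i - b) \<and> rs ! (i - b) \<le> qs ! (Suc i - b)"
      if "b \<le> i" "i < b + length rs"
    proof -
      have "i - b < length rs" using that by simp
      from qs(4)[OF this] show ?thesis using that by (simp add: Suc_diff_le)
    qed
    moreover have "i - b = length rs" if "b \<le> i" "\<not> i < b + length rs" "i < b + length qs"
      using that qs(2) by simp
    moreover have "Suc i - b = 0" if "i < b" "\<not> Suc i < b"
      using that by simp
    ultimately show "(replicate b (-1) @ qs @ replicate a 0) ! i \<le> (replicate b (-1) @ rs @ replicate a 0) ! i \<and>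
        (replicate b (-1) @ rs @ replicate a 0) ! i \<le> (replicate b (-1) @ qs @ replicate a 0) ! Suc i"
      using i qs(2) by (subst (1 2 3 4) nth) auto
  qed
  have dist: "distinct qs" using qs(3) by (simp add: strict_sorted_iff)
  \<comment> \<open>Zeros of \<open>qs\<close> that reached an endpoint are moved into the powers of
    x and 1 + x; the others stay inside.\<close>
  define ys where "ys = filter (\<lambda>y. y \<noteq> -1) (filter (\<lambda>y. y \<noteq> 0) qs)"
  have "root_poly qs = [:0, 1:] ^ of_bool (0 \<in> set qs) * root_poly (filter (\<lambda>y. y \<noteq> 0) qs)"
    using root_poly_filter[OF dist, of 0] by simp
  also have "root_poly (filter (\<lambda>y. y \<noteq> 0) qs) = [:1, 1:] ^ of_bool (-1 \<in> set qs) * root_poly ys"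
    using root_poly_filter[of "filter (\<lambda>y. y \<noteq> 0) qs" "-1"] dist by (simp add: ys_def)
  finally have root_qs: "root_poly qs = [:0, 1:] ^ of_bool (0 \<in> set qs) *
      ([:1, 1:] ^ of_bool (-1 \<in> set qs) * root_poly ys)" .
  have eqs: "c + a = d \<longleftrightarrow> c = real b + 1" "c + a = 0 \<longleftrightarrow> c = - real a"
    by (auto simp: d_def)
  have "F' = smult k' ([:1, 1:] ^ (b + of_bool (c = real b + 1)) *
      ([:0, 1:] ^ (a + of_bool (c = - real a)) * root_poly ys))"
    unfolding F'_eq root_qs qs(6,7) eqs by (simp only: power_add mult_ac)
  moreover have "sorted_wrt (<) ys" "\<forall>r\<in>set ys. -1 < r \<and> r < 0"
    using qs(3,5) by (auto simp: ys_def sorted_wrt_filter order.strict_iff_order)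
  ultimately show "simple_zeros_form (a + of_bool (c = - real a)) (b + of_bool (c = real b + 1)) F'"
    unfolding simple_zeros_form_def using k' by blast
qed

section \<open>Ferrers posets\<close>

text \<open>Padding by 0 makes the row lengths of partitions with different numbers of rows
  comparable.\<close>

definition row_len :: "nat list \<Rightarrow> nat \<Rightarrow> nat" where
  "row_len lam i = (if i < length lam then lam ! i else 0)"

lemma mem_ferrers: "(i, j) \<in> ferrers lam \<longleftrightarrow> 1 \<le> i \<and> 1 \<le> j \<and> j \<le> row_len lam (i - 1)"
  by (auto simp: ferrers_def row_len_def split: if_splits)

lemma ferrers_eq_row_shape: "length lam \<le> n \<Longrightarrow> ferrers lam = row_shape n (row_len lam)"
  by (auto simp: mem_ferrers row_shape_def row_len_def split: if_splits)

lemma row_len_antimono: "is_partition lam \<Longrightarrow> i \<le> k \<Longrightarrow> row_len lam k \<le> row_len lam i"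
  by (cases "i = k") (auto simp: row_len_def is_partition_def sorted_wrt_iff_nth_less)

lemma row_len_pos: "is_partition lam \<Longrightarrow> 1 \<le> row_len lam i \<longleftrightarrow> i < length lam"
  by (auto simp: row_len_def is_partition_def Suc_le_eq)

text \<open>Labels increase along rows, so a descent of labels between comparable cells requires
  different rows. Conversely, any two comparable cells in different rows are separated by the strict
  step down from the first of them.\<close>

lemma P_partitions_eq_tableaux:
  assumes lam: "is_partition lam" and cs: "column_strict lam \<omega>"
  shows "P_partitions (ferrers lam) \<omega> n = tableaux n (ferrers lam)"
proof -
  have row: "\<omega> (i, j) \<le> \<omega> (i, j')" if "(i, j) \<in> ferrers lam" "(i, j') \<in> ferrers lam" "j \<le> j'" for i j j'
    using that(3,2)
  proof (induction j' rule: dec_induct)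
    case (step k)
    have "(i, k) \<in> ferrers lam" using step.prems step.hyps that(1) by (auto simp: mem_ferrers)
    thus ?case using step cs by (fastforce simp: column_strict_def)
  qed simp
  show ?thesis
    unfolding P_partitions_def tableaux_def
  proof (intro Collect_cong conj_cong refl iffI)
    fix \<sigma> :: "nat \<times> nat \<Rightarrow> nat"
    assume part: "(\<forall>x\<in>ferrers lam. \<forall>y\<in>ferrers lam. x \<le> y \<longrightarrow> \<sigma> y \<le> \<sigma> x) \<and>
      (\<forall>x\<in>ferrers lam. \<forall>y\<in>ferrers lam. x < y \<and> \<omega> y < \<omega> x \<longrightarrow> \<sigma> y < \<sigma> x)"
    show "\<forall>i j i' j'. (i, j) \<in> ferrers lam \<longrightarrow> (i', j') \<in> ferrers lam \<longrightarrow> i \<le> i' \<longrightarrow> j \<le> j' \<longrightarrow>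
        \<sigma> (i', j') \<le> \<sigma> (i, j) \<and> (i < i' \<longrightarrow> \<sigma> (i', j') < \<sigma> (i, j))"
    proof (intro allI impI conjI)
      fix i j i' j' assume mem: "(i, j) \<in> ferrers lam" "(i', j') \<in> ferrers lam" and le: "i \<le> i'" "j \<le> j'"
      show "\<sigma> (i', j') \<le> \<sigma> (i, j)" using part mem le by auto
      assume "i < i'"
      \<comment> \<open>The cell directly below lies in the diagram and mediates: strict descent to
        it, weak descent from it to \<open>(i', j')\<close>.\<close>
      hence below: "(i + 1, j) \<in> ferrers lam"
        using ferrers_down[OF lam mem(2), of "i + 1" j] le mem(1) by (simp add: mem_ferrers)
      have "(i, j) < (i + 1, j)" by (simp add: less_le_not_le)
      moreover have "\<omega> (i + 1, j) < \<omega> (i, j)"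
        using cs mem(1) below by (simp add: column_strict_def)
      ultimately have "\<sigma> (i + 1, j) < \<sigma> (i, j)" using part mem(1) below by blast
      moreover have "\<sigma> (i', j') \<le> \<sigma> (i + 1, j)"
        using part mem(2) below le \<open>i < i'\<close> by auto
      ultimately show "\<sigma> (i', j') < \<sigma> (i, j)" by simp
    qed
  next
    fix \<sigma> :: "nat \<times> nat \<Rightarrow> nat"
    assume tab: "\<forall>i j i' j'. (i, j) \<in> ferrers lam \<longrightarrow> (i', j') \<in> ferrers lam \<longrightarrow> i \<le> i' \<longrightarrow> j \<le> j' \<longrightarrow>
        \<sigma> (i', j') \<le> \<sigma> (i, j) \<and> (i < i' \<longrightarrow> \<sigma> (i', j') < \<sigma> (i, j))"
    have "\<sigma> (i', j') < \<sigma> (i, j)"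
      if "(i, j) \<in> ferrers lam" "(i', j') \<in> ferrers lam" "(i, j) < (i', j')" "\<omega> (i', j') < \<omega> (i, j)" for i j i' j'
    proof -
      have "i \<le> i'" "j \<le> j'" using that(3) by (auto simp: less_le_not_le)
      moreover from this have "i \<noteq> i'" using row[of i j j'] that by auto
      ultimately show ?thesis using tab that by (simp add: le_neq_implies_less)
    qed
    thus "(\<forall>x\<in>ferrers lam. \<forall>y\<in>ferrers lam. x \<le> y \<longrightarrow> \<sigma> y \<le> \<sigma> x) \<and>
      (\<forall>x\<in>ferrers lam. \<forall>y\<in>ferrers lam. x < y \<and> \<omega> y < \<omega> x \<longrightarrow> \<sigma> y < \<sigma> x)"
      using tab by (auto simp: split_paired_all)
  qed
qed

text \<open>The first column would need \<open>length lam\<close> distinct entries.\<close>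

lemma tableaux_ferrers_empty:
  assumes lam: "is_partition lam" and "n < length lam"
  shows "tableaux n (ferrers lam) = {}"
proof (rule ccontr)
  assume "tableaux n (ferrers lam) \<noteq> {}"
  then obtain \<sigma> where \<sigma>: "\<sigma> \<in> tableaux n (ferrers lam)" by blast
  have mem: "(length lam, 1) \<in> ferrers lam"
    using assms row_len_pos[OF lam, of "length lam - 1"] by (auto simp: mem_ferrers)
  have "\<sigma> (length lam, 1) + length lam \<le> Suc n"
    by (rule tableaux_row_bound[OF \<sigma> _ mem]) (use assms ferrers_down[OF lam] in \<open>auto simp: mem_ferrers\<close>)
  moreover have "1 \<le> \<sigma> (length lam, 1)" using tableaux_range[OF \<sigma> mem] by simp
  ultimately show False using assms by simp
qed

section \<open>Adding one cell to a partition\<close>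

lemma young_covers_row_len:
  assumes "young_covers lam mu"
  obtains p where "p < length lam" "1 \<le> row_len lam p" "row_len mu = (row_len lam)(p := row_len lam p - 1)"
proof -
  obtain i j where lam: "is_partition lam" and p: "(i, j) \<in> ferrers lam"
    and mu: "ferrers mu = ferrers lam - {(i, j)}"
    using assms by (auto simp: young_covers_iff)
  have row: "{1..row_len nu k} = {j. (Suc k, j) \<in> ferrers nu}" for nu k
    by (auto simp: mem_ferrers)
  have i: "1 \<le> i" "1 \<le> j" "j \<le> row_len lam (i - 1)" using p by (auto simp: mem_ferrers)
  have "row_len mu k = ((row_len lam)(i - 1 := row_len lam (i - 1) - 1)) k" for k
  proof -
    have "{1..row_len mu k} = {1..row_len lam k} - (if k = i - 1 then {j} else {})"
      unfolding row mu using i by auto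
    hence "card {1..row_len mu k} = card ({1..row_len lam k} - (if k = i - 1 then {j} else {}))"
      by (rule arg_cong)
    thus ?thesis using i by (auto simp: card_Diff_singleton split: if_splits)
  qed
  moreover have "1 \<le> row_len lam (i - 1)" using i by simp
  moreover from this have "i - 1 < length lam" using row_len_pos[OF lam] by blast
  ultimately show ?thesis by (intro that[of "i - 1"]) auto
qed

text \<open>The last cell of the last row can always be removed.\<close>

lemma ex_young_covers:
  assumes lam: "is_partition lam" and "lam \<noteq> []"
  shows "\<exists>mu. young_covers lam mu"
proof -
  define l where "l = length lam"
  define p where "p = (l, row_len lam (l - 1))"
  have l: "l - 1 < length lam" "1 \<le> l" using assms by (auto simp: l_def Suc_le_eq)
  have p: "p \<in> ferrers lam"
    using l row_len_pos[OF lam, of "l - 1"] by (simp add: p_def mem_ferrers)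
  have "\<exists>nu. is_partition nu \<and> ferrers nu = ferrers lam - {p}"
  proof (rule down_set_is_ferrers)
    show "1 \<le> i \<and> 1 \<le> j" if "(i, j) \<in> ferrers lam - {p}" for i j
      using that by (auto simp: mem_ferrers)
    show "(i', j') \<in> ferrers lam - {p}"
      if "(i, j) \<in> ferrers lam - {p}" "1 \<le> i'" "i' \<le> i" "1 \<le> j'" "j' \<le> j" for i j i' j'
    proof -
      have "i \<le> l" using that by (auto simp: ferrers_def l_def)
      moreover have "(i, j) \<noteq> p" "j \<le> row_len lam (i - 1)"
        using that(1) by (auto simp: mem_ferrers)
      ultimately have "(i', j') \<noteq> p" using that(2-5) by (auto simp: p_def)
      thus ?thesis using ferrers_down[OF lam _ that(2-5)] that(1) by simp
    qed
  qed simp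
  thus ?thesis using lam p by (auto simp: young_covers_iff)
qed

text \<open>\<open>c\<close> is the content, column minus row, of the removed cell, as
  \<open>p\<close> counts rows from 0. The product formula relates the counts for
  \<open>n \<ge> l\<close>; smaller \<open>n\<close> need a separate check.\<close>

lemma E_poly_young_covers:
  assumes cov: "young_covers lam mu" and cs: "column_strict lam \<omega>"
    and p: "p < length lam" "1 \<le> row_len lam p" "row_len mu = (row_len lam)(p := row_len lam p - 1)"
    and c: "c = real (row_len lam p) - 1 - real p"
  obtains K where "K \<noteq> 0" "smult K (E_poly (ferrers lam) \<omega>) = content_op c 1 (E_poly (ferrers mu) \<omega>)"
proof -
  have lam: "is_partition lam" and mu: "is_partition mu" and sub: "ferrers mu \<subseteq> ferrers lam"
    using cov by (auto simp: young_covers_def)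
  have cs_mu: "column_strict mu \<omega>"
    using cs sub unfolding column_strict_def by blast
  define l where "l = length lam"
  have anti: "row_len lam k \<le> row_len lam i" "row_len mu k \<le> row_len mu i" if "i \<le> k" for i k
    using that row_len_antimono lam mu by auto
  have zero: "row_len lam i = 0" if "l \<le> i" for i
    using that by (simp add: row_len_def l_def)
  have len_mu: "length mu \<le> l"
    using row_len_pos[OF mu, of l] zero[of l] p by (simp add: l_def split: if_splits)
  \<comment> \<open>The constant is the quotient of the two product formulas at
    \<open>n = l\<close>.\<close>
  define K where "K = weyl_prod l (row_len mu) * (l + c) / weyl_prod l (row_len lam)"
  have pos: "weyl_prod l (row_len lam) > 0" "weyl_prod l (row_len mu) > 0"
    using anti by (auto intro!: weyl_prod_pos)
  have "l + c > 0" using p by (simp add: c l_def)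
  hence "K \<noteq> 0" using pos by (simp add: K_def)
  moreover have "smult K (E_poly (ferrers lam) \<omega>) = content_op c 1 (E_poly (ferrers mu) \<omega>)"
  proof (rule content_op_E_poly)
    fix n
    show "real (card (P_partitions (ferrers lam) \<omega> n)) * K =
        real (card (P_partitions (ferrers mu) \<omega> n)) * (real n + c)"
      unfolding P_partitions_eq_tableaux[OF lam cs] P_partitions_eq_tableaux[OF mu cs_mu]
    proof (cases "l \<le> n")
      case True
      define N where "N nu = real (card (tableaux n (ferrers nu)))" for nu
      have N: "N nu * (\<Prod>j<n. fact j) = weyl_prod n (row_len nu)" if "is_partition nu" "length nu \<le> n" for nu
        unfolding N_def ferrers_eq_row_shape[OF that(2)]
        by (rule card_tableaux_weyl_prod) (rule row_len_antimono[OF that(1)])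
      have fact: "(\<Prod>j<n. fact j :: real) > 0" by (intro prod_pos) simp
      have "weyl_prod n (row_len lam) * (weyl_prod l (row_len mu) * (l + c)) =
          weyl_prod l (row_len lam) * (weyl_prod n (row_len mu) * (n + c))"
        by (rule weyl_prod_remove_cell[of p]) (use p zero True c in \<open>auto simp: l_def\<close>)
      hence "weyl_prod n (row_len lam) * K = weyl_prod n (row_len mu) * (n + c)"
        using pos(1) by (simp add: K_def field_simps)
      hence "(N lam * K) * (\<Prod>j<n. fact j) = (N mu * (n + c)) * (\<Prod>j<n. fact j)"
        using True len_mu N[OF lam] N[OF mu] by (simp add: l_def mult_ac flip: N)
      thus "real (card (tableaux n (ferrers lam))) * K = real (card (tableaux n (ferrers mu))) * (real n + c)"
        using fact by (simp add: N_def)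
    next
      case False
      show "real (card (tableaux n (ferrers lam))) * K = real (card (tableaux n (ferrers mu))) * (real n + c)"
      proof (cases "n < length mu")
        case True
        thus ?thesis using False tableaux_ferrers_empty[OF mu] tableaux_ferrers_empty[OF lam] by (simp add: l_def)
      next
        \<comment> \<open>Here \<open>mu\<close> has lost the row of \<open>lam\<close> with index
          \<open>n\<close>, so the removed cell was alone in it and the factor \<open>n + c\<close>
          vanishes.\<close>
        case mu_n: False
        have n: "n < length lam" using False by (simp add: l_def)
        hence "\<not> 1 \<le> row_len mu n" "1 \<le> row_len lam n"
          using row_len_pos[OF mu] row_len_pos[OF lam] mu_n by auto
        hence "n = p \<and> row_len lam p = 1" using p(3) by (auto split: if_splits)
        hence "real n + c = 0" by (simp add: c)
        thus ?thesis using n tableaux_ferrers_empty[OF lam] by simp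
      qed
    qed
  qed simp_all
  ultimately show ?thesis by (rule that)
qed

section \<open>Induction along Young's lattice\<close>

text \<open>The content of the added cell lies in the admissible range: it is least exactly when a
  new row starts, and attains the upper bound exactly when a nonempty first row is extended.\<close>

lemma interlaces_step:
  assumes cov: "young_covers lam mu" and cs: "column_strict lam \<omega>"
    and IH: "simple_zeros_form (length mu) (row_len mu 0 - 1) (E_poly (ferrers mu) \<omega>)"
  shows "interlaces (E_poly (ferrers mu) \<omega>) (E_poly (ferrers lam) \<omega>)"
    "simple_zeros_form (length lam) (row_len lam 0 - 1) (E_poly (ferrers lam) \<omega>)"
proof -
  have lam: "is_partition lam" and mu: "is_partition mu"
    using cov by (auto simp: young_covers_def)
  obtain p where p: "p < length lam" "1 \<le> row_len lam p" "row_len mu = (row_len lam)(p := row_len lam p - 1)"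
    using young_covers_row_len[OF cov] .
  define c where "c = real (row_len lam p) - 1 - real p"
  obtain K where K: "K \<noteq> 0" "smult K (E_poly (ferrers lam) \<omega>) = content_op c 1 (E_poly (ferrers mu) \<omega>)"
    using E_poly_young_covers[OF cov cs p c_def] .
  have mem_mu: "i < length mu \<longleftrightarrow> i < length lam \<and> \<not> (i = p \<and> row_len lam p = 1)" for i
    using row_len_pos[OF mu, of i] row_len_pos[OF lam, of i] p by (auto split: if_splits)
  have a: "- real (length mu) \<le> c \<and> length mu + of_bool (c = - real (length mu)) = length lam"
  proof (cases "length mu = p")
    case True
    have "row_len lam p = 1" using mem_mu[of p] p(1) True by simp
    moreover have "length lam = Suc p"
    proof (rule antisym)
      have "\<not> Suc p < length mu" using True by simp
      thus "length lam \<le> Suc p" using mem_mu[of "Suc p"] by simp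
    qed (use p in simp)
    ultimately show ?thesis using True by (simp add: c_def)
  next
    case False
    have "length mu = length lam"
    proof (rule antisym)
      show "length mu \<le> length lam"
        using mem_mu[of "length lam"] by (simp add: not_less)
      show "length lam \<le> length mu"
        using mem_mu[of "length mu"] False by simp
    qed
    thus ?thesis using p by (simp add: c_def)
  qed
  have b: "c \<le> real (row_len mu 0 - 1) + 1 \<and>
      (row_len mu 0 - 1) + of_bool (c = real (row_len mu 0 - 1) + 1) = row_len lam 0 - 1"
  proof (cases "p = 0")
    case True
    \<comment> \<open>For empty \<open>mu\<close> the truncated \<open>row_len mu 0 - 1\<close> is
      0; then \<open>c = 0\<close> stays below the upper bound, and the order at -1 rightly remains
      0.\<close>
    thus ?thesis using p by (cases "row_len lam 0 = 1") (auto simp: c_def of_nat_diff)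
  next
    case False
    moreover have "row_len lam p \<le> row_len lam 0" by (rule row_len_antimono[OF lam]) simp
    ultimately show ?thesis using p by (auto simp: c_def of_nat_diff)
  qed
  from simple_zeros_form_content_op[OF IH K(2,1)] a b
  show "interlaces (E_poly (ferrers mu) \<omega>) (E_poly (ferrers lam) \<omega>)"
    "simple_zeros_form (length lam) (row_len lam 0 - 1) (E_poly (ferrers lam) \<omega>)"
    by simp_all
qed

text \<open>Cells are removed one at a time, down to the empty diagram, whose polynomial is 1 and
  has no zeros.\<close>

lemma simple_zeros_form_E_poly:
  assumes "is_partition lam" "column_strict lam \<omega>"
  shows "simple_zeros_form (length lam) (row_len lam 0 - 1) (E_poly (ferrers lam) \<omega>)"
  using assms
proof (induction "card (ferrers lam)" arbitrary: lam rule: less_induct)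
  case less
  show ?case
  proof (cases "lam = []")
    case True
    have "ferrers lam = {}" using True by (simp add: ferrers_def)
    thus ?thesis
      using True unfolding simple_zeros_form_def
      by (intro exI[of _ 1] exI[of _ "[]"]) (simp add: E_poly_def row_len_def)
  next
    case False
    then obtain mu where mu: "young_covers lam mu" using ex_young_covers less.prems by blast
    hence sub: "is_partition mu" "ferrers mu \<subset> ferrers lam" by (simp_all add: young_covers_def)
    have "column_strict mu \<omega>"
      using less.prems(2) sub(2) unfolding column_strict_def by blast
    moreover have "card (ferrers mu) < card (ferrers lam)" using sub(2) by (simp add: psubset_card_mono)
    ultimately show ?thesis
      using interlaces_step(2)[OF mu less.prems(2)] less.hyps[of mu] sub(1) by blast
  qed
qed

theorem theorem16:
  fixes lam :: "nat list" and \<omega> :: "nat \<times> nat \<Rightarrow> nat"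
  assumes "is_partition lam"
    and "labelled_poset (ferrers lam) \<omega>"
    and "column_strict lam \<omega>"
  shows "real_rooted (E_poly (ferrers lam) \<omega>) \<and>
    (\<forall>mu. young_covers lam mu \<longrightarrow>
      interlaces (E_poly (ferrers mu) \<omega>) (E_poly (ferrers lam) \<omega>))"
proof (intro conjI allI impI)
  show "real_rooted (E_poly (ferrers lam) \<omega>)"
    using simple_zeros_form_E_poly[OF assms(1,3)]
    unfolding simple_zeros_form_def root_poly_pad by (metis real_rooted_root_poly)
  fix mu assume mu: "young_covers lam mu"
  hence "is_partition mu" "ferrers mu \<subseteq> ferrers lam" by (auto simp: young_covers_def)
  moreover from this have "column_strict mu \<omega>"
    using assms(3) unfolding column_strict_def by blast
  ultimately show "interlaces (E_poly (ferrers mu) \<omega>) (E_poly (ferrers lam) \<omega>)"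
    using interlaces_step(1)[OF mu assms(3)] simple_zeros_form_E_poly by blast
qed

end
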